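(* Let $\mathbb{X}$ be a reflexive separable real Banach space and let $\mu$ be a cylinder probability measure of type 1 on $\mathbb{X}$. Assume that (i) $\mu(\{x\in\mathbb{X}:\langle x,x^*\rangle=a\})=0$ for all $x^*\in\mathbb{X}^*\setminus\{0\}$ and $a\in\mathbb{R}$; (ii) the interior of $D_0(\mu)$ is non-empty. Then the following hold. 1. The set $\mathbf{B}(\mu)=\{B_A(\mu): A\in\mathcal{C},\ \mu(A)>0\}$ of all barycenters with respect to $\mu$ equals the interior of $\mathbf{S}(\mu)$. 2. Every point $x\in\mathbf{B}(\mu)$ has a representation $x=B_H(\mu)$ with $H\in\mathcal{H}^{\mathbb{X}}$, $\mu(H)>0$. This representation is unique in the following sense: if $H,G\in\mathcal{H}^{\mathbb{X}}$ have $\mu(H)>0$, $\mu(G)>0$ and $B_H(\mu)=B_G(\mu)$, then $\mu(H\Delta G)=0$.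
   Context: $\mathbb{X}^*$ is the dual of $\mathbb{X}$ and $\langle\cdot,\cdot\rangle$ the duality pairing. $\mathcal{C}$ is the cylinder algebra of $\mathbb{X}$: all sets $\{x:(\langle x,x_1^*\rangle,\dots,\langle x,x_m^*\rangle)\in B\}$ with $m\ge1$, $x_1^*,\dots,x_m^*\in\mathbb{X}^*$, $B\subset\mathbb{R}^m$ Borel. A cylinder probability measure of type 1 is an additive function $\mu:\mathcal{C}\to[0,1]$ such that (a) for all $x_1^*,\dots,x_m^*$ the restriction of $\mu$ to the $\sigma$-algebra $\sigma(\langle\cdot,x_1^*\rangle,\dots,\langle\cdot,x_m^*\rangle)$ is a ($\sigma$-additive) probability measure; (b) there is $C_\mu>0$ with $\int_{\mathbb{X}}|\langle x,x^*\rangle|\mu(dx)\le C_\mu\|x^*\|$ for all $x^*\in\mathbb{X}^*$. Such $\mu$ is the law of a generalized random element $X$, i.e. a bounded linear map $X:\mathbb{X}^*\to L_1(\Omega,\mathcal{F},P)$, $x^*\mapsto\langle X,x^*\rangle$, on some probability space, such that $(\langle X,x_1^*\rangle,\dots,\langle X,x_m^*\rangle)$ has under $P$ the law of $(\langle\cdot,x_1^*\rangle,\dots,\langle\cdot,x_m^*\rangle)$ under $\mu$. $\sigma(X)$ is the $\sigma$-algebra generated by all $\langle X,x^*\rangle$, $x^*\in\mathbb{X}^*$. For a bounded random variable $\eta$, $E[\eta X]\in\mathbb{X}$ is the unique element with $\langle E[\eta X],x^*\rangle=E(\eta\langle X,x^*\rangle)$ for all $x^*$ (it exists by reflexivity).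 For $\alpha\in(0,1]$, $D_\alpha(\mu)=\{\frac1\alpha E[\eta X]:\ \eta:\Omega\to[0,1]\ \sigma(X)\text{-measurable},\ E\eta=\alpha\}$, and $D_0(\mu)=\bigcup_{\alpha\in(0,1]}D_\alpha(\mu)$. $\mathcal{H}^{\mathbb{X}}$ is the class of all sets $\{x\in\mathbb{X}:\langle x,x^*\rangle\ge a\}$ with $x^*\in\mathbb{X}^*$ ($x^*=0$ allowed), $a\in\mathbb{R}$. $\mathbf{S}(\mu)=\bigcap\{H\in\mathcal{H}^{\mathbb{X}}:\mu(H)=1\}$. For a cylinder set $A$ with $\mu(A)>0$, its barycenter is $B_A(\mu)=\frac{1}{\mu(A)}\int_A x\,\mu(dx)$, the integral being the element of $\mathbb{X}$ defined weakly by $\langle\int_A x\,\mu(dx),x^*\rangle=\int_A\langle x,x^*\rangle\mu(dx)$ for all $x^*\in\mathbb{X}^*$. *)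

theory Defs
  imports "HOL-Probability.Probability"
begin

type_synonym 'a dual = "'a \<Rightarrow>\<^sub>L real"

definition reflexive_space :: "'a::real_normed_vector itself \<Rightarrow> bool" where
  "reflexive_space _ \<longleftrightarrow>
     (\<forall>\<phi> :: 'a dual dual. \<exists>x::'a. \<forall>f. blinfun_apply \<phi> f = blinfun_apply f x)"


section \<open>Cylinder measures\<close>

text \<open>A tuple of functionals is given by \<open>m\<close> and the values of \<open>fs\<close> on \<open>{..<m}\<close>;
  real \<open>m\<close>-tuples are points of the product space \<open>\<Pi>\<^sub>M i\<in>{..<m}. borel\<close>.\<close>

definition tuple_map :: "nat \<Rightarrow> (nat \<Rightarrow> 'a::real_normed_vector dual) \<Rightarrow> 'a \<Rightarrow> nat \<Rightarrow> real" where
  "tuple_map m fs x = (\<lambda>i\<in>{..<m}. blinfun_apply (fs i) x)"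

definition cylinder_sets :: "'a::real_normed_vector set set" where
  "cylinder_sets =
     {{x. tuple_map m fs x \<in> B} | m fs B. m \<ge> 1 \<and> B \<in> sets (\<Pi>\<^sub>M i\<in>{..<m}. (borel :: real measure))}"

definition tuple_algebra :: "nat \<Rightarrow> (nat \<Rightarrow> 'a::real_normed_vector dual) \<Rightarrow> 'a set set" where
  "tuple_algebra m fs = sigma_sets UNIV {{x. blinfun_apply (fs i) x \<in> B} | i B. i < m \<and> B \<in> sets borel}"

definition tuple_measure ::
    "('a::real_normed_vector set \<Rightarrow> real) \<Rightarrow> nat \<Rightarrow> (nat \<Rightarrow> 'a dual) \<Rightarrow> 'a measure" where
  "tuple_measure \<mu> m fs = measure_of UNIV (tuple_algebra m fs) (\<lambda>A. ennreal (\<mu> A))"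

text \<open>In the first-moment condition the integral is a nonnegative extended one, so the bound
  includes integrability.\<close>

definition cylinder_prob_measure1 :: "('a::real_normed_vector set \<Rightarrow> real) \<Rightarrow> bool" where
  "cylinder_prob_measure1 \<mu> \<longleftrightarrow>
     (\<forall>A\<in>cylinder_sets. 0 \<le> \<mu> A \<and> \<mu> A \<le> 1) \<and>
     additive cylinder_sets \<mu> \<and>
     (\<forall>m fs. m \<ge> 1 \<longrightarrow>
        measure_space UNIV (tuple_algebra m fs) (\<lambda>A. ennreal (\<mu> A)) \<and> \<mu> UNIV = 1) \<and>
     (\<exists>C>0. \<forall>f. (\<integral>\<^sup>+x. ennreal \<bar>blinfun_apply f x\<bar> \<partial>tuple_measure \<mu> 1 (\<lambda>_. f))
                 \<le> ennreal (C * norm f))"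

text \<open>Integral of a function depending on finitely many functionals. The tuple used to compute it
  does not matter; see \<open>cylinder_integral_eq\<close> below.\<close>

definition cylinder_integral ::
    "('a::real_normed_vector set \<Rightarrow> real) \<Rightarrow> ('a \<Rightarrow> real) \<Rightarrow> real" where
  "cylinder_integral \<mu> h =
     (THE r. \<exists>m fs. m \<ge> 1 \<and> h \<in> borel_measurable (tuple_measure \<mu> m fs) \<and>
                    r = (\<integral>x. h x \<partial>tuple_measure \<mu> m fs))"

definition barycenter ::
    "('a::real_normed_vector set \<Rightarrow> real) \<Rightarrow> 'a set \<Rightarrow> 'a" where
  "barycenter \<mu> A = (1 / \<mu> A) *\<^sub>R
     (THE y. \<forall>f. blinfun_apply f y = cylinder_integral \<mu> (\<lambda>x. indicator A x * blinfun_apply f x))"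

definition barycenters :: "('a::real_normed_vector set \<Rightarrow> real) \<Rightarrow> 'a set" where
  "barycenters \<mu> = {barycenter \<mu> A | A. A \<in> cylinder_sets \<and> \<mu> A > 0}"

definition halfspaces :: "'a::real_normed_vector set set" where
  "halfspaces = {{x. blinfun_apply f x \<ge> a} | (f :: 'a dual) (a :: real). True}"

definition supp_hull :: "('a::real_normed_vector set \<Rightarrow> real) \<Rightarrow> 'a set" where
  "supp_hull \<mu> = \<Inter>{H \<in> halfspaces. \<mu> H = 1}"


section \<open>Generalized random elements\<close>

text \<open>\<open>X f\<close> is a representative of a class in \<open>L\<^sub>1(P)\<close>, hence linearity holds almost surely.\<close>

definition generalized_random_element ::
    "'w measure \<Rightarrow> ('a::real_normed_vector dual \<Rightarrow> 'w \<Rightarrow> real) \<Rightarrow> bool" where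
  "generalized_random_element P X \<longleftrightarrow>
     prob_space P \<and>
     (\<forall>f. integrable P (X f)) \<and>
     (\<forall>f g. AE \<omega> in P. X (f + g) \<omega> = X f \<omega> + X g \<omega>) \<and>
     (\<forall>c f. AE \<omega> in P. X (c *\<^sub>R f) \<omega> = c * X f \<omega>) \<and>
     (\<exists>C. \<forall>f. (\<integral>\<omega>. \<bar>X f \<omega>\<bar> \<partial>P) \<le> C * norm f)"

definition has_cylinder_law ::
    "'w measure \<Rightarrow> ('a::real_normed_vector dual \<Rightarrow> 'w \<Rightarrow> real) \<Rightarrow> ('a set \<Rightarrow> real) \<Rightarrow> bool" where
  "has_cylinder_law P X \<mu> \<longleftrightarrow>
     (\<forall>m fs. m \<ge> 1 \<longrightarrow>
        distr P (\<Pi>\<^sub>M i\<in>{..<m}. borel) (\<lambda>\<omega>. \<lambda>i\<in>{..<m}. X (fs i) \<omega>) =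
        distr (tuple_measure \<mu> m fs) (\<Pi>\<^sub>M i\<in>{..<m}. borel) (tuple_map m fs))"

definition generated_algebra ::
    "'w measure \<Rightarrow> ('a::real_normed_vector dual \<Rightarrow> 'w \<Rightarrow> real) \<Rightarrow> 'w measure" where
  "generated_algebra P X = sigma (space P) {X f -` B \<inter> space P | f B. B \<in> sets borel}"

definition weighted_mean ::
    "'w measure \<Rightarrow> ('a::real_normed_vector dual \<Rightarrow> 'w \<Rightarrow> real) \<Rightarrow> ('w \<Rightarrow> real) \<Rightarrow> 'a" where
  "weighted_mean P X \<eta> = (THE y. \<forall>f. blinfun_apply f y = (\<integral>\<omega>. \<eta> \<omega> * X f \<omega> \<partial>P))"

text \<open>\<open>trimmed_region P X \<alpha>\<close> and \<open>trimmed_region0 P X\<close> depend on \<open>(P, X)\<close> only through the law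
  of \<open>X\<close>; every cylinder measure of type 1 is such a law by \<open>ex_generalized_random_element\<close>.\<close>

definition trimmed_region ::
    "'w measure \<Rightarrow> ('a::real_normed_vector dual \<Rightarrow> 'w \<Rightarrow> real) \<Rightarrow> real \<Rightarrow> 'a set" where
  "trimmed_region P X \<alpha> =
     {(1 / \<alpha>) *\<^sub>R weighted_mean P X \<eta> | \<eta>.
        \<eta> \<in> borel_measurable (generated_algebra P X) \<and>
        (\<forall>\<omega>\<in>space P. 0 \<le> \<eta> \<omega> \<and> \<eta> \<omega> \<le> 1) \<and>
        (\<integral>\<omega>. \<eta> \<omega> \<partial>P) = \<alpha>}"

definition trimmed_region0 ::
    "'w measure \<Rightarrow> ('a::real_normed_vector dual \<Rightarrow> 'w \<Rightarrow> real) \<Rightarrow> 'a set" where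
  "trimmed_region0 P X = (\<Union>\<alpha>\<in>{0<..1}. trimmed_region P X \<alpha>)"


section \<open>Well-definedness\<close>

lemma sigma_algebra_tuple_algebra: "sigma_algebra UNIV (tuple_algebra m fs)"
  unfolding tuple_algebra_def by (rule sigma_algebra_sigma_sets) auto

lemma space_tuple_measure [simp]: "space (tuple_measure \<mu> m fs) = UNIV"
  unfolding tuple_measure_def by (simp add: space_measure_of)

lemma sets_tuple_measure [simp]: "sets (tuple_measure \<mu> m fs) = tuple_algebra m fs"
  unfolding tuple_measure_def
  by (simp add: sigma_algebra.sets_measure_of_eq[OF sigma_algebra_tuple_algebra])

lemma emeasure_tuple_measure:
  assumes "cylinder_prob_measure1 \<mu>" "m \<ge> 1" "A \<in> tuple_algebra m fs"
  shows "emeasure (tuple_measure \<mu> m fs) A = ennreal (\<mu> A)"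
  unfolding tuple_measure_def
  by (rule emeasure_measure_of_sigma[OF sigma_algebra_tuple_algebra])
     (use assms in \<open>auto simp: cylinder_prob_measure1_def measure_space_def\<close>)

lemma prob_space_tuple_measure:
  assumes "cylinder_prob_measure1 \<mu>" "m \<ge> 1"
  shows "prob_space (tuple_measure \<mu> m fs)"
proof
  have "UNIV \<in> tuple_algebra m fs"
    by (metis sets.top sets_tuple_measure space_tuple_measure)
  then show "emeasure (tuple_measure \<mu> m fs) (space (tuple_measure \<mu> m fs)) = 1"
    using emeasure_tuple_measure[OF assms] assms by (simp add: cylinder_prob_measure1_def)
qed

lemma measurable_tuple_measure:
  assumes "i < m"
  shows "blinfun_apply (fs i) \<in> borel_measurable (tuple_measure \<mu> m fs)"
proof (rule measurableI)
  fix B :: "real set" assume "B \<in> sets borel"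
  then show "blinfun_apply (fs i) -` B \<inter> space (tuple_measure \<mu> m fs) \<in> sets (tuple_measure \<mu> m fs)"
    using assms by (auto simp: tuple_algebra_def vimage_def intro!: sigma_sets.Basic)
qed simp

lemma measurable_tuple_map:
  "tuple_map m fs \<in> measurable (tuple_measure \<mu> m fs) (\<Pi>\<^sub>M i\<in>{..<m}. borel)"
  unfolding tuple_map_def
  by (rule measurable_restrict) (auto intro: measurable_tuple_measure)

lemma tuple_algebra_eq:
  "tuple_algebra m fs =
     {{x. tuple_map m fs x \<in> B} | B. B \<in> sets (\<Pi>\<^sub>M i\<in>{..<m}. (borel :: real measure))}"
proof -
  let ?N = "\<Pi>\<^sub>M i\<in>{..<m}. (borel :: real measure)"
  let ?V = "vimage_algebra UNIV (tuple_map m fs) ?N"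
  have sp: "tuple_map m fs \<in> UNIV \<rightarrow> space ?N"
    by (auto simp: tuple_map_def space_PiM)
  have V: "sets ?V = {{x. tuple_map m fs x \<in> B} | B. B \<in> sets ?N}"
    by (subst sets_vimage_algebra2[OF sp]) (auto simp: vimage_def)
  have "sets ?V \<subseteq> tuple_algebra m fs"
  proof
    fix A assume "A \<in> sets ?V"
    then obtain B where "B \<in> sets ?N" "A = tuple_map m fs -` B"
      unfolding V by (auto simp: vimage_def)
    then show "A \<in> tuple_algebra m fs"
      using measurable_sets[OF measurable_tuple_map[where m=m and fs=fs and \<mu>="\<lambda>_. 0"]] by simp
  qed
  moreover have "tuple_algebra m fs \<subseteq> sets ?V"
  proof -
    have "{x. blinfun_apply (fs i) x \<in> B} \<in> sets ?V" if "i < m" "B \<in> sets borel" for i B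
    proof -
      have "(\<lambda>w. w i) -` B \<inter> space ?N \<in> sets ?N"
        using that by (intro measurable_sets[OF measurable_component_singleton]) auto
      moreover have "{x. blinfun_apply (fs i) x \<in> B} =
          {x. tuple_map m fs x \<in> (\<lambda>w. w i) -` B \<inter> space ?N}"
        using that sp by (auto simp: tuple_map_def)
      ultimately show ?thesis unfolding V by blast
    qed
    then have "sigma_sets (space ?V) {{x. blinfun_apply (fs i) x \<in> B} | i B. i < m \<and> B \<in> sets borel}
        \<subseteq> sets ?V"
      by (intro sets.sigma_sets_subset) auto
    then show ?thesis by (simp add: tuple_algebra_def)
  qed
  ultimately show ?thesis using V by simp
qed

lemma cylinder_sets_eq: "cylinder_sets = (\<Union>m\<in>{1..}. \<Union>fs. tuple_algebra m fs)"
  unfolding cylinder_sets_def tuple_algebra_eq by fast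

lemma tuple_algebra_mono:
  assumes "fs ` {..<m} \<subseteq> gs ` {..<n}"
  shows "tuple_algebra m fs \<subseteq> tuple_algebra n gs"
  unfolding tuple_algebra_def
proof (rule sigma_sets_mono')
  show "{{x. blinfun_apply (fs i) x \<in> B} | i B. i < m \<and> B \<in> sets borel}
      \<subseteq> {{x. blinfun_apply (gs i) x \<in> B} | i B. i < n \<and> B \<in> sets borel}"
  proof clarify
    fix i and B :: "real set" assume i: "i < m" "B \<in> sets borel"
    then obtain j where "j < n" "fs i = gs j" using assms by fastforce
    then show "\<exists>k D. {x. blinfun_apply (fs i) x \<in> B} = {x. blinfun_apply (gs k) x \<in> D} \<and>
        k < n \<and> D \<in> sets borel"
      using i by metis
  qed
qed

lemma integral_tuple_measure_mono:
  assumes \<mu>: "cylinder_prob_measure1 \<mu>" and m: "m \<ge> 1" "n \<ge> 1"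
    and sub: "fs ` {..<m} \<subseteq> gs ` {..<n}"
    and h: "h \<in> borel_measurable (tuple_measure \<mu> m fs)"
  shows "(\<integral>x. h x \<partial>tuple_measure \<mu> m fs) = (\<integral>x. (h x :: real) \<partial>tuple_measure \<mu> n gs)"
proof (rule integral_subalgebra[OF h])
  fix A assume "A \<in> sets (tuple_measure \<mu> m fs)"
  then show "emeasure (tuple_measure \<mu> m fs) A = emeasure (tuple_measure \<mu> n gs) A"
    using tuple_algebra_mono[OF sub] m by (simp add: emeasure_tuple_measure[OF \<mu>] subset_iff)
qed (use tuple_algebra_mono[OF sub] in auto)

lemma cylinder_integral_eq:
  assumes \<mu>: "cylinder_prob_measure1 \<mu>" and m: "m \<ge> 1"
    and h: "h \<in> borel_measurable (tuple_measure \<mu> m fs)"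
  shows "cylinder_integral \<mu> h = (\<integral>x. h x \<partial>tuple_measure \<mu> m fs)"
  unfolding cylinder_integral_def
proof (rule the_equality)
  fix r assume "\<exists>n gs. n \<ge> 1 \<and> h \<in> borel_measurable (tuple_measure \<mu> n gs) \<and>
                    r = (\<integral>x. h x \<partial>tuple_measure \<mu> n gs)"
  then obtain n gs where n: "n \<ge> 1" and h': "h \<in> borel_measurable (tuple_measure \<mu> n gs)"
    and r: "r = (\<integral>x. h x \<partial>tuple_measure \<mu> n gs)" by blast
  define hs where "hs i = (if i < m then fs i else gs (i - m))" for i
  have f: "fs ` {..<m} \<subseteq> hs ` {..<m + n}"
    by (force simp: hs_def)
  have g: "gs ` {..<n} \<subseteq> hs ` {..<m + n}"
  proof
    fix y assume "y \<in> gs ` {..<n}"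
    then obtain i where "i < n" "y = gs i" by auto
    then have "y = hs (m + i)" "m + i \<in> {..<m + n}" by (auto simp: hs_def)
    then show "y \<in> hs ` {..<m + n}" by blast
  qed
  show "r = (\<integral>x. h x \<partial>tuple_measure \<mu> m fs)"
    using integral_tuple_measure_mono[OF \<mu> m _ f h] integral_tuple_measure_mono[OF \<mu> n _ g h'] r m
    by simp
qed (use m h in blast)

text \<open>Every cylinder measure of type 1 is the law of a generalized random element
  (Kolmogorov extension, indexed by the dual space).\<close>

lemma ex_generalized_random_element:
  fixes \<mu> :: "'a::real_normed_vector set \<Rightarrow> real"
  assumes \<mu>: "cylinder_prob_measure1 \<mu>"
  shows "\<exists>P :: ('a dual \<Rightarrow> real) measure.
           generalized_random_element P (\<lambda>f \<omega>. \<omega> f) \<and> has_cylinder_law P (\<lambda>f \<omega>. \<omega> f) \<mu>"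
proof -
  have "\<exists>(m::nat) fs. m \<ge> 1 \<and> J \<subseteq> fs ` {..<m}" if J: "finite J" for J :: "'a dual set"
  proof -
    obtain e where e: "bij_betw e {0..<card (insert 0 J)} (insert 0 J)"
      using ex_bij_betw_nat_finite[of "insert 0 J"] J by blast
    have "card (insert 0 J) \<ge> 1" using J card_gt_0_iff[of "insert 0 J"] by simp
    moreover have "J \<subseteq> e ` {..<card (insert 0 J)}"
      using e by (auto simp: bij_betw_def lessThan_atLeast0)
    ultimately show ?thesis by blast
  qed
  then obtain M E where ME: "\<And>J :: 'a dual set. finite J \<Longrightarrow> M J \<ge> (1::nat) \<and> J \<subseteq> E J ` {..<M J}"
    by metis
  define T where "T J = tuple_measure \<mu> (M J) (E J)" for J
  define R where "R J x = (\<lambda>f\<in>J. blinfun_apply f x)" for J :: "'a dual set" and x :: 'a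
  define Q where "Q J = distr (T J) (\<Pi>\<^sub>M f\<in>J. (borel :: real measure)) (R J)" for J
  have Rm: "R J \<in> measurable (tuple_measure \<mu> m fs) (\<Pi>\<^sub>M f\<in>J. borel)"
    if sub: "J \<subseteq> fs ` {..<m}" for J m fs
    unfolding R_def
  proof (rule measurable_restrict)
    fix f assume "f \<in> J"
    then obtain i where "i < m" "f = fs i" using sub by auto
    then show "blinfun_apply f \<in> borel_measurable (tuple_measure \<mu> m fs)"
      using measurable_tuple_measure by blast
  qed
  have em: "emeasure (distr (tuple_measure \<mu> m fs) N g) A = ennreal (\<mu> (g -` A))"
    if "m \<ge> 1" "g \<in> measurable (tuple_measure \<mu> m fs) N" "A \<in> sets N" for m fs A g
      and N :: "'c measure"
    using measurable_sets[OF that(2,3)] that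
    by (simp add: emeasure_distr emeasure_tuple_measure[OF \<mu>])
  have Qeq: "Q J = distr (tuple_measure \<mu> m fs) (\<Pi>\<^sub>M f\<in>J. borel) (R J)"
    if "finite J" "J \<subseteq> fs ` {..<m}" "m \<ge> 1" for J m fs
    unfolding Q_def T_def
    by (rule measure_eqI) (use ME that in \<open>auto simp: em Rm\<close>)
  have proj: "polish_projective UNIV Q"
    unfolding polish_projective_def
  proof (rule projective_family.intro)
    fix J H :: "'a dual set" assume JH: "J \<subseteq> H" "finite H" "H \<subseteq> UNIV"
    have "J \<subseteq> E H ` {..<M H}" "M H \<ge> 1" "finite J" using ME[of H] JH finite_subset by auto
    then have "Q J = distr (T H) (PiM J (\<lambda>_. borel)) (R J)" using Qeq T_def by simp
    also have "\<dots> = distr (T H) (PiM J (\<lambda>_. borel)) ((\<lambda>w. restrict w J) \<circ> R H)"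
      using JH by (intro distr_cong) (auto simp: R_def fun_eq_iff)
    also have "\<dots> = distr (Q H) (PiM J (\<lambda>_. borel)) (\<lambda>w. restrict w J)"
      unfolding Q_def using JH ME[of H] Rm[of H "E H" "M H"]
      by (intro distr_distr[symmetric]) (auto simp: T_def intro!: measurable_restrict_subset)
    finally show "Q J = distr (Q H) (PiM J (\<lambda>_. borel)) (\<lambda>w. restrict w J)" .
  next
    fix J :: "'a dual set" assume "finite J" "J \<subseteq> UNIV"
    then show "prob_space (Q J)"
      unfolding Q_def T_def using ME[of J] Rm
      by (intro prob_space.prob_space_distr prob_space_tuple_measure[OF \<mu>]) auto
  qed
  then interpret polish_projective UNIV Q .
  define P where "P = lim"
  have P_sets [simp]: "sets P = sets (PiM UNIV (\<lambda>_. borel))" "space P = UNIV"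
    using sets_lim sets_eq_imp_space_eq[OF sets_lim] by (auto simp: P_def space_PiM)
  have Xm [measurable]: "(\<lambda>\<omega>. \<omega> f) \<in> borel_measurable P" for f
    using measurable_component_singleton[of f UNIV "\<lambda>_. borel"]
    by (simp add: measurable_cong_sets[OF P_sets(1) refl])
  have restr: "(\<lambda>\<omega>. restrict \<omega> J) \<in> measurable P (PiM J (\<lambda>_. borel))" for J
    by (simp add: measurable_cong_sets[OF P_sets(1) refl] measurable_restrict_subset)
  have PJ: "distr P (PiM J (\<lambda>_. borel)) (\<lambda>\<omega>. restrict \<omega> J) = Q J" if J: "finite J" for J
  proof (rule measure_eqI)
    fix A assume "A \<in> sets (distr P (PiM J (\<lambda>_. borel)) (\<lambda>\<omega>. restrict \<omega> J))"
    then have A: "A \<in> sets (PiM J (\<lambda>_. borel))" by simp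
    have "emeasure P ((\<lambda>\<omega>. restrict \<omega> J) -` A) = emeasure (Q J) A"
      using emeasure_lim_emb[of J A] A J by (simp add: P_def prod_emb_def)
    then show "emeasure (distr P (PiM J (\<lambda>_. borel)) (\<lambda>\<omega>. restrict \<omega> J)) A = emeasure (Q J) A"
      using A by (simp add: emeasure_distr[OF restr])
  qed (simp add: Q_def)
  have prob: "prob_space P"
  proof
    have "emeasure P UNIV = emeasure (Q {}) {\<lambda>_. undefined}"
      using emeasure_lim_emb[of "{}" "{\<lambda>_. undefined}"]
      by (simp add: P_def prod_emb_def space_PiM sets_PiM_empty restrict_def vimage_def)
    also have "\<dots> = 1"
      using prob_space.emeasure_space_1[OF prob_space_P[of "{}"]] space_P[of "{}"]
      by (simp add: space_PiM)
    finally show "emeasure P (space P) = 1" by simp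
  qed
  have law: "distr P N (\<lambda>\<omega>. g (restrict \<omega> (fs ` {..<m}))) =
      distr (tuple_measure \<mu> m fs) N (\<lambda>x. g (R (fs ` {..<m}) x))"
    if m: "m \<ge> 1" and g: "g \<in> measurable (PiM (fs ` {..<m}) (\<lambda>_. borel)) N"
    for m fs g and N :: "'c measure"
  proof -
    let ?J = "fs ` {..<m}"
    have "distr P N (g \<circ> (\<lambda>\<omega>. restrict \<omega> ?J)) = distr (Q ?J) N g"
      using distr_distr[OF g restr] PJ[of ?J] by simp
    also have "\<dots> = distr (tuple_measure \<mu> m fs) N (g \<circ> R ?J)"
      using distr_distr[OF g Rm[of ?J fs m]] Qeq[of ?J fs m] m by simp
    finally show ?thesis by (simp add: o_def)
  qed
  have lawX: "has_cylinder_law P (\<lambda>f \<omega>. \<omega> f) \<mu>"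
    unfolding has_cylinder_law_def
  proof (intro allI impI)
    fix m :: nat and fs :: "nat \<Rightarrow> 'a dual" assume m: "m \<ge> 1"
    have "(\<lambda>w. \<lambda>i\<in>{..<m}. w (fs i)) \<in>
        measurable (PiM (fs ` {..<m}) (\<lambda>_. borel :: real measure)) (\<Pi>\<^sub>M i\<in>{..<m}. borel)"
      by (intro measurable_restrict measurable_component_singleton) auto
    from law[OF m this]
    show "distr P (\<Pi>\<^sub>M i\<in>{..<m}. borel) (\<lambda>\<omega>. \<lambda>i\<in>{..<m}. \<omega> (fs i)) =
        distr (tuple_measure \<mu> m fs) (\<Pi>\<^sub>M i\<in>{..<m}. borel) (tuple_map m fs)"
      by (simp add: R_def tuple_map_def[abs_def] cong: restrict_cong)
  qed
  have law1: "distr P borel (\<lambda>\<omega>. \<omega> f) = distr (tuple_measure \<mu> 1 (\<lambda>_. f)) borel (blinfun_apply f)" for f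
    using law[of 1 "\<lambda>w. w f" "\<lambda>_. f" borel] by (simp add: R_def lessThan_Suc)
  obtain C where C: "C > 0"
    "\<And>f. (\<integral>\<^sup>+x. ennreal \<bar>blinfun_apply f x\<bar> \<partial>tuple_measure \<mu> 1 (\<lambda>_. f)) \<le> ennreal (C * norm f)"
    using \<mu> unfolding cylinder_prob_measure1_def by blast
  have nn: "(\<integral>\<^sup>+\<omega>. ennreal \<bar>\<omega> f\<bar> \<partial>P) \<le> ennreal (C * norm f)" for f
  proof -
    have "(\<integral>\<^sup>+\<omega>. ennreal \<bar>\<omega> f\<bar> \<partial>P) = (\<integral>\<^sup>+t. ennreal \<bar>t\<bar> \<partial>distr P borel (\<lambda>\<omega>. \<omega> f))"
      by (subst nn_integral_distr) auto
    also have "\<dots> = (\<integral>\<^sup>+x. ennreal \<bar>blinfun_apply f x\<bar> \<partial>tuple_measure \<mu> 1 (\<lambda>_. f))"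
      unfolding law1 using measurable_tuple_measure[of 0 1 "\<lambda>_. f" \<mu>]
      by (subst nn_integral_distr) auto
    finally show ?thesis using C by simp
  qed
  have int: "integrable P (\<lambda>\<omega>. \<omega> f)" for f
    by (rule integrableI_bounded) (use nn[of f] in \<open>auto intro: le_less_trans\<close>)
  have bd: "(\<integral>\<omega>. \<bar>\<omega> f\<bar> \<partial>P) \<le> C * norm f" for f
  proof -
    have "ennreal (\<integral>\<omega>. \<bar>\<omega> f\<bar> \<partial>P) \<le> ennreal (C * norm f)"
      using nn[of f] int[of f] by (subst nn_integral_eq_integral[symmetric]) auto
    then show ?thesis using C by simp
  qed
  have AE: "AE \<omega> in P. p (restrict \<omega> (fs ` {..<m}))"
    if m: "m \<ge> 1" and p: "p \<in> measurable (PiM (fs ` {..<m}) (\<lambda>_. borel)) (count_space UNIV)"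
      and px: "\<And>x. p (R (fs ` {..<m}) x)" for m and fs :: "nat \<Rightarrow> 'a dual" and p :: "('a dual \<Rightarrow> real) \<Rightarrow> bool"
  proof -
    let ?J = "fs ` {..<m}"
    have eq: "Q ?J = distr P (PiM ?J (\<lambda>_. borel)) (\<lambda>\<omega>. restrict \<omega> ?J)"
      using PJ[of ?J] by simp
    have "AE w in Q ?J. p w"
      unfolding Qeq[of ?J fs m, OF _ subset_refl m, simplified]
      by (subst AE_distr_iff) (use Rm[of ?J fs m] p px in \<open>auto simp: pred_def\<close>)
    then show ?thesis
      unfolding eq by (subst (asm) AE_distr_iff[OF restr]) (use p in \<open>auto simp: pred_def\<close>)
  qed
  have add: "AE \<omega> in P. \<omega> (f + g) = \<omega> f + \<omega> g" for f g
  proof -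
    define fs where "fs i = (if i = 0 then f else if i = 1 then g else f + g)" for i :: nat
    have J: "fs ` {..<3} = {f, g, f + g}" by (auto simp: fs_def numeral_3_eq_3 lessThan_Suc)
    have "AE \<omega> in P. (\<lambda>w. w (f + g) = w f + w g) (restrict \<omega> (fs ` {..<3}))"
    proof (rule AE)
      have [measurable]: "(\<lambda>w. w h) \<in> borel_measurable (PiM {f, g, f + g} (\<lambda>_. borel :: real measure))"
        if "h \<in> {f, g, f + g}" for h
        using that by (intro measurable_component_singleton)
      show "Measurable.pred (PiM (fs ` {..<3}) (\<lambda>_. borel)) (\<lambda>w :: _ \<Rightarrow> real. w (f + g) = w f + w g)"
        unfolding J pred_def by measurable
    qed (simp_all add: J R_def blinfun.add_left)
    then show ?thesis by (simp add: J)
  qed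
  have scale: "AE \<omega> in P. \<omega> (c *\<^sub>R f) = c * \<omega> f" for c f
  proof -
    define fs where "fs i = (if i = 0 then f else c *\<^sub>R f)" for i :: nat
    have J: "fs ` {..<2} = {f, c *\<^sub>R f}" by (auto simp: fs_def numeral_2_eq_2 lessThan_Suc)
    have "AE \<omega> in P. (\<lambda>w. w (c *\<^sub>R f) = c * w f) (restrict \<omega> (fs ` {..<2}))"
    proof (rule AE)
      have [measurable]: "(\<lambda>w. w h) \<in> borel_measurable (PiM {f, c *\<^sub>R f} (\<lambda>_. borel :: real measure))"
        if "h \<in> {f, c *\<^sub>R f}" for h
        using that by (intro measurable_component_singleton)
      show "Measurable.pred (PiM (fs ` {..<2}) (\<lambda>_. borel)) (\<lambda>w :: _ \<Rightarrow> real. w (c *\<^sub>R f) = c * w f)"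
        unfolding J pred_def by measurable
    qed (simp_all add: J R_def blinfun.scaleR_left)
    then show ?thesis by (simp add: J)
  qed
  show ?thesis
    using lawX int bd add scale prob
    unfolding generalized_random_element_def by blast
qed

end

theory Submission
  imports Defs "HOL-Complex_Analysis.Great_Picard"
begin

text \<open>The interior of \<open>trimmed_region0 P X\<close> and the uniform boundedness principle provide a point \<open>y\<close>
  and \<open>d > 0\<close> with \<open>E (X f - f y)\<^sup>+ \<ge> d \<parallel>f\<parallel>\<close> for all \<open>f\<close>. By weak* sequential compactness the same
  holds, with another constant, at every \<open>x\<close> such that \<open>X f \<le> f x\<close> fails with positive probability
  for each \<open>f \<noteq> 0\<close>. Barycenters (because hyperplanes are null) and interior points of \<open>supp_hull \<mu>\<close>
  have this property. Conversely, coercivity at \<open>x\<close> puts a ball around \<open>x\<close> into \<open>supp_hull \<mu>\<close>, and it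
  makes the convex weak* lower semicontinuous function \<open>f \<mapsto> E (1 + X f - f x)\<^sup>+\<close> attain its minimum at
  some \<open>f\<close>; the first-order condition there says that \<open>x\<close> is the barycenter of the half-space
  \<open>{z. f z \<ge> f x - 1}\<close>.\<close>

section \<open>Functional analysis\<close>

text \<open>Positive homogeneity is demanded as an inequality only: using it for both
  \<open>c\<close> and \<open>1 / c\<close> gives equality, and the infima built below then need a
  single estimate.\<close>

definition sublinear :: "('a::real_vector \<Rightarrow> real) \<Rightarrow> bool" where
  "sublinear p \<longleftrightarrow> (\<forall>x y. p (x + y) \<le> p x + p y) \<and> p 0 = 0 \<and>
     (\<forall>c>0. \<forall>x. p (c *\<^sub>R x) \<le> c * p x)"

lemma sublinear_add: "sublinear p \<Longrightarrow> p (x + y) \<le> p x + p y"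
  and sublinear_zero: "sublinear p \<Longrightarrow> p 0 = 0"
  by (auto simp: sublinear_def)

lemma sublinear_scaleR:
  assumes p: "sublinear p" and c: "c \<ge> 0"
  shows "p (c *\<^sub>R x) = c * p x"
proof (cases "c = 0")
  case False
  then have "c > 0" using c by simp
  then have "p (c *\<^sub>R x) \<le> c * p x" and "p ((1 / c) *\<^sub>R (c *\<^sub>R x)) \<le> (1 / c) * p (c *\<^sub>R x)"
    using p unfolding sublinear_def by (blast, metis zero_less_divide_1_iff)
  then show ?thesis using \<open>c > 0\<close> by (simp add: field_simps)
qed (simp add: sublinear_zero[OF p])

lemma sublinear_neg_le:
  assumes "sublinear p" shows "- p (- x) \<le> p x"
  using sublinear_add[OF assms, of x "- x"] sublinear_zero[OF assms] by simp

lemma sublinear_norm: "sublinear norm"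
  by (simp add: sublinear_def norm_triangle_ineq)

text \<open>Zorn's lemma, with the pointwise infimum of a chain as lower bound. The infimum is
  finite because every sublinear \<open>q\<close> below \<open>p\<close> satisfies
  \<open>q x >= - q (- x) >= - p (- x)\<close>.\<close>

lemma ex_minimal_sublinear:
  fixes p :: "'a::real_vector \<Rightarrow> real"
  assumes p: "sublinear p"
  shows "\<exists>q. sublinear q \<and> q \<le> p \<and> (\<forall>r. sublinear r \<longrightarrow> r \<le> q \<longrightarrow> r = q)"
proof -
  let ?A = "{q. sublinear q \<and> q \<le> p}"
  let ?R = "\<lambda>q r :: 'a \<Rightarrow> real. r \<le> q"
  have "\<exists>m\<in>?A. \<forall>q\<in>?A. ?R m q \<longrightarrow> q = m"
  proof (rule predicate_Zorn)
    show "partial_order_on ?A (relation_of ?R ?A)"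
      by (rule partial_order_on_relation_ofI) auto
  next
    fix C assume "C \<in> Chains (relation_of ?R ?A)"
    then have sub: "C \<subseteq> ?A" and tot: "\<And>q r. q \<in> C \<Longrightarrow> r \<in> C \<Longrightarrow> q \<le> r \<or> r \<le> q"
      unfolding Chains_def relation_of_def by auto
    show "\<exists>u\<in>?A. \<forall>q\<in>C. u \<le> q"
    proof (cases "C = {}")
      case True
      then show ?thesis using p by auto
    next
      case False
      define u where "u x = (INF q\<in>C. q x)" for x
      have lb: "- p (- x) \<le> q x" if "q \<in> C" for q x
        using sublinear_neg_le[of q x] that sub le_funD[of q p "- x"] by fastforce
      have bdd: "bdd_below ((\<lambda>q. q x) ` C)" for x
        by (rule bdd_belowI2[of _ "- p (- x)"]) (rule lb)
      have uq: "u x \<le> q x" if "q \<in> C" for q x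
        unfolding u_def by (rule cINF_lower[OF bdd that])
      have gt: "l \<le> u x" if "\<And>q. q \<in> C \<Longrightarrow> l \<le> q x" for l x
        unfolding u_def by (rule cINF_greatest[OF False that])
      have sub_u: "u (x + y) - u x \<le> u y" for x y
      proof (rule gt)
        fix r assume r: "r \<in> C"
        have "u (x + y) - r y \<le> u x"
        proof (rule gt)
          fix q assume q: "q \<in> C"
          \<comment> \<open>An infimum of sublinear functions need not be subadditive. In a chain
            the smaller of \<open>q\<close> and \<open>r\<close> can replace both, and its own
            subadditivity suffices.\<close>
          obtain s where s: "s \<in> C" "s \<le> q" "s \<le> r" using tot[OF q r] q r by blast
          have "u (x + y) \<le> s x + s y"
            using uq[OF s(1), of "x + y"] sublinear_add[of s x y] s(1) sub by fastforce
          then show "u (x + y) - r y \<le> q x" using s le_funD[of s q x] le_funD[of s r y] by linarith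
        qed
        then show "u (x + y) - u x \<le> r y" by simp
      qed
      have "u (x + y) \<le> u x + u y" for x y
        using sub_u[of x y] by linarith
      moreover have "u (c *\<^sub>R x) \<le> c * u x" if "c > 0" for c x
      proof -
        have "u (c *\<^sub>R x) / c \<le> u x"
        proof (rule gt)
          fix q assume q: "q \<in> C"
          have "u (c *\<^sub>R x) \<le> c * q x"
            using uq[OF q, of "c *\<^sub>R x"] sublinear_scaleR[of q c x] q sub that by fastforce
          then show "u (c *\<^sub>R x) / c \<le> q x" using that by (simp add: field_simps)
        qed
        then show ?thesis using that by (simp add: field_simps)
      qed
      moreover have "u 0 = 0"
      proof -
        have "(\<lambda>q. q 0) ` C = {0}" using False sub sublinear_zero by fastforce
        then show ?thesis by (simp add: u_def)
      qed
      ultimately have "sublinear u"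
        unfolding sublinear_def by blast
      moreover have "u \<le> p"
        using False uq sub by (metis (no_types, lifting) all_not_in_conv le_fun_def mem_Collect_eq order_trans subsetD)
      ultimately show ?thesis using uq by (auto simp: le_fun_def)
    qed
  qed
  then obtain m where "sublinear m" "m \<le> p" "\<And>q. sublinear q \<Longrightarrow> q \<le> p \<Longrightarrow> q \<le> m \<Longrightarrow> q = m"
    by auto
  then show ?thesis using order_trans by metis
qed

text \<open>\<open>directional_inf p y\<close> is a sublinear minorant of \<open>p\<close> whose value at \<open>- y\<close> is at most
  \<open>- p y\<close>. A pointwise minimal sublinear function therefore equals all of its own
  \<open>directional_inf\<close>s, which forces it to be additive; applied to the norm this yields the
  Hahn--Banach functional without extending anything from subspaces.\<close>

definition directional_inf :: "('a::real_vector \<Rightarrow> real) \<Rightarrow> 'a \<Rightarrow> 'a \<Rightarrow> real" where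
  "directional_inf p y x = (INF t\<in>{0..}. p (x + t *\<^sub>R y) - t * p y)"

text \<open>All terms lie above \<open>- p (- x)\<close>, so the infimum is finite. Parameters
  \<open>t\<close> at \<open>x\<close> and \<open>s\<close> at \<open>z\<close> combine to
  \<open>t + s\<close> at \<open>x + z\<close>, and scaling \<open>x\<close> by \<open>c\<close>
  turns \<open>t\<close> into \<open>c * t\<close>; the infimum over all \<open>t\<close> absorbs
  both changes.\<close>

lemma directional_inf:
  assumes p: "sublinear p"
  shows sublinear_directional_inf: "sublinear (directional_inf p y)"
    and directional_inf_le: "t \<ge> 0 \<Longrightarrow> directional_inf p y x \<le> p (x + t *\<^sub>R y) - t * p y"
proof -
  have lb: "- p (- x) \<le> p (x + t *\<^sub>R y) - t * p y" if "t \<ge> 0" for t x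
    using sublinear_add[OF p, of "x + t *\<^sub>R y" "- x"] sublinear_scaleR[OF p that, of y] by simp
  have le: "directional_inf p y x \<le> p (x + t *\<^sub>R y) - t * p y" if "t \<ge> 0" for t x
    unfolding directional_inf_def
    by (rule cINF_lower) (use lb that in \<open>auto intro!: bdd_belowI2[of _ "- p (- x)"]\<close>)
  then show "t \<ge> 0 \<Longrightarrow> directional_inf p y x \<le> p (x + t *\<^sub>R y) - t * p y" for t x .
  have gt: "l \<le> directional_inf p y x" if "\<And>t. t \<ge> 0 \<Longrightarrow> l \<le> p (x + t *\<^sub>R y) - t * p y" for l x
    unfolding directional_inf_def by (rule cINF_greatest) (use that in auto)
  let ?d = "directional_inf p y"
  have sub_d: "?d (x + z) - ?d x \<le> ?d z" for x z
  proof (rule gt)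
    fix s :: real assume s: "s \<ge> 0"
    have "?d (x + z) - (p (z + s *\<^sub>R y) - s * p y) \<le> ?d x"
    proof (rule gt)
      fix t :: real assume t: "t \<ge> 0"
      have "?d (x + z) \<le> p ((x + t *\<^sub>R y) + (z + s *\<^sub>R y)) - (t + s) * p y"
        using le[of "t + s" "x + z"] s t by (simp add: algebra_simps)
      also have "\<dots> \<le> p (x + t *\<^sub>R y) + p (z + s *\<^sub>R y) - (t + s) * p y"
        using sublinear_add[OF p] by simp
      finally show "?d (x + z) - (p (z + s *\<^sub>R y) - s * p y) \<le> p (x + t *\<^sub>R y) - t * p y"
        by (simp add: algebra_simps)
    qed
    then show "?d (x + z) - ?d x \<le> p (z + s *\<^sub>R y) - s * p y" by simp
  qed
  have "?d (x + z) \<le> ?d x + ?d z" for x z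
    using sub_d[of x z] by linarith
  moreover have "?d (c *\<^sub>R x) \<le> c * ?d x" if c: "c > 0" for c x
  proof -
    have "?d (c *\<^sub>R x) / c \<le> ?d x"
    proof (rule gt)
      fix t :: real assume t: "t \<ge> 0"
      have "?d (c *\<^sub>R x) \<le> p (c *\<^sub>R (x + t *\<^sub>R y)) - (c * t) * p y"
        using le[of "c * t" "c *\<^sub>R x"] t c by (simp add: algebra_simps)
      also have "\<dots> = c * (p (x + t *\<^sub>R y) - t * p y)"
        using sublinear_scaleR[OF p, of c "x + t *\<^sub>R y"] c by (simp add: algebra_simps)
      finally show "?d (c *\<^sub>R x) / c \<le> p (x + t *\<^sub>R y) - t * p y"
        using c by (simp add: field_simps)
    qed
    then show ?thesis using c by (simp add: field_simps)
  qed
  moreover have "?d 0 = 0"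
  proof (rule antisym)
    show "?d 0 \<le> 0" using le[of 0 0] by (simp add: sublinear_zero[OF p])
    show "0 \<le> ?d 0" by (rule gt) (simp add: sublinear_scaleR[OF p])
  qed
  ultimately show "sublinear ?d"
    unfolding sublinear_def by blast
qed

lemma minimal_sublinear_additive:
  assumes p: "sublinear p" and min: "\<And>r. sublinear r \<Longrightarrow> r \<le> p \<Longrightarrow> r = p"
  shows "p (x + y) = p x + p y"
proof -
  have "directional_inf p y \<le> p"
    using directional_inf_le[OF p, of 0 y] by (simp add: le_fun_def)
  then have "directional_inf p y = p" by (intro min sublinear_directional_inf[OF p])
  \<comment> \<open>The parameter 1 gives \<open>p x \<le> p (x + y) - p y\<close>, the reverse of
    subadditivity.\<close>
  then show ?thesis
    using directional_inf_le[OF p, of 1 y x] sublinear_add[OF p, of x y] by simp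
qed

text \<open>Minimising below \<open>directional_inf norm x\<close> instead of below the norm pins
  down a value: the parameter 1 shows that this function is at most \<open>- norm x\<close> at
  \<open>- x\<close>, so a linear minorant is at least \<open>norm x\<close> at
  \<open>x\<close>.\<close>

lemma dual_separates_points:
  fixes x :: "'a::real_normed_vector"
  assumes "x \<noteq> 0"
  shows "\<exists>f :: 'a dual. blinfun_apply f x \<noteq> 0"
proof -
  define p where "p = directional_inf norm x"
  have p: "sublinear p" unfolding p_def by (rule sublinear_directional_inf[OF sublinear_norm])
  have p_norm: "p z \<le> norm z" for z
    using directional_inf_le[OF sublinear_norm, of 0 x z] by (simp add: p_def)
  have px: "p (- x) \<le> - norm x"
    using directional_inf_le[OF sublinear_norm, of 1 x "- x"] by (simp add: p_def)
  obtain q where q: "sublinear q" "q \<le> p" and min: "\<And>r. sublinear r \<Longrightarrow> r \<le> q \<Longrightarrow> r = q"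
    using ex_minimal_sublinear[OF p] by auto
  have add: "q (u + v) = q u + q v" for u v
    by (rule minimal_sublinear_additive[OF q(1) min])
  have neg: "q (- u) = - q u" for u
    using add[of u "- u"] sublinear_zero[OF q(1)] by simp
  have scale: "q (c *\<^sub>R u) = c * q u" for c u
    using sublinear_scaleR[OF q(1), of c u] sublinear_scaleR[OF q(1), of "- c" u] neg[of "c *\<^sub>R u"]
    by (cases "c \<ge> 0") auto
  have le: "q u \<le> norm u" for u
    using le_funD[OF q(2), of u] p_norm[of u] by simp
  have "bounded_linear q"
  proof (rule bounded_linear_intro[where K=1])
    fix u show "norm (q u) \<le> norm u * 1" using le[of u] le[of "- u"] neg[of u] by simp
  qed (auto simp: add scale)
  moreover have "q x \<noteq> 0"
    using le_funD[OF q(2), of "- x"] px neg[of x] assms by (smt (verit) norm_eq_zero norm_ge_zero)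
  ultimately show ?thesis by (metis bounded_linear_Blinfun_apply)
qed

lemma dual_ext:
  fixes x y :: "'a::real_normed_vector"
  assumes "\<And>f :: 'a dual. blinfun_apply f x = blinfun_apply f y"
  shows "x = y"
  using dual_separates_points[of "x - y"] assms by (auto simp: blinfun.diff_right)

section \<open>Uniform boundedness and weak* sequential compactness\<close>

text \<open>By Baire's theorem one of the closed sets \<open>T n\<close>, which cover the space,
  contains a ball.\<close>

lemma uniform_boundedness:
  fixes K :: "('a::banach \<Rightarrow>\<^sub>L 'b::real_normed_vector) set"
  assumes "\<And>u. \<exists>M. \<forall>f\<in>K. norm (blinfun_apply f u) \<le> M"
  shows "\<exists>M. \<forall>f\<in>K. norm f \<le> M"
proof -
  define T where "T n = {u. \<forall>f\<in>K. norm (blinfun_apply f u) \<le> real n}" for n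
  have cl: "closed (T n)" for n
  proof -
    have "T n = (\<Inter>f\<in>K. {u. norm (blinfun_apply f u) \<le> real n})" by (auto simp: T_def)
    also have "closed \<dots>"
      by (intro closed_INT ballI closed_Collect_le continuous_intros)
    finally show ?thesis .
  qed
  have "u \<in> \<Union>(range T)" for u
  proof -
    obtain M where "\<forall>f\<in>K. norm (blinfun_apply f u) \<le> M" using assms by blast
    moreover obtain n where "M \<le> real n" using real_arch_simple by blast
    ultimately have "u \<in> T n" unfolding T_def by fastforce
    then show ?thesis by blast
  qed
  then have un: "\<Union>(range T) = UNIV" by blast
  have "\<exists>n. interior (T n) \<noteq> {}"
  proof (rule ccontr)
    assume "\<not> ?thesis"
    then have "euclidean interior_of \<Union>(range T) = {}"
      by (intro Baire_category_alt) (auto simp: completely_metrizable_space_euclidean cl)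
    then show False by (simp add: un)
  qed
  then obtain n u r where r: "r > 0" "ball u r \<subseteq> T n"
    by (metis all_not_in_conv interior_subset open_contains_ball open_interior subset_trans)
  have "norm f \<le> 4 * n / r" if f: "f \<in> K" for f
  proof (rule norm_blinfun_bound)
    fix v :: 'a
    show "norm (blinfun_apply f v) \<le> 4 * n / r * norm v"
    proof (cases "v = 0")
      case False
      \<comment> \<open>The vector \<open>v\<close> is rescaled to norm \<open>r / 2\<close>. Its
        image is the difference of two values bounded by \<open>n\<close>, whence the constant
        \<open>2 * n / (r / 2)\<close>.\<close>
      define w where "w = (r / 2 / norm v) *\<^sub>R v"
      have "norm w < r" using r(1) False by (simp add: w_def)
      then have "u \<in> T n" "u + w \<in> T n" using r by (auto simp: dist_norm intro!: subsetD[OF r(2)])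
      then have "norm (blinfun_apply f u) \<le> n" "norm (blinfun_apply f u + blinfun_apply f w) \<le> n"
        using f by (auto simp: T_def blinfun.add_right)
      then have "norm (blinfun_apply f w) \<le> 2 * n"
        using norm_triangle_ineq4[of "blinfun_apply f u + blinfun_apply f w" "blinfun_apply f u"] by simp
      then show ?thesis using r(1) False by (simp add: w_def blinfun.scaleR_right field_simps)
    qed simp
  qed (use r in simp)
  then show ?thesis by blast
qed

text \<open>A diagonal argument gives convergence on a countable dense set; the common Lipschitz
  constant \<open>M\<close> carries the Cauchy property to every point.\<close>

lemma bounded_dual_weakstar_subsequence:
  fixes f :: "nat \<Rightarrow> 'a::real_normed_vector dual"
  assumes sep: "separable_space (euclidean :: 'a topology)" and M: "\<And>n. norm (f n) \<le> M"
  shows "\<exists>k g. strict_mono (k :: nat \<Rightarrow> nat) \<and>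
    (\<forall>x. (\<lambda>n. blinfun_apply (f (k n)) x) \<longlonglongrightarrow> blinfun_apply g x)"
proof -
  obtain S :: "'a set" where S: "countable S" "closure S = UNIV"
    using sep by (auto simp: separable_space_def)
  have bd: "norm (blinfun_apply (f n) x) \<le> M * norm x" for n x
    using norm_blinfun[of "f n" x] M[of n] by (meson mult_right_mono norm_ge_zero order_trans)
  have M0: "M \<ge> 0" using M[of 0] norm_ge_zero order_trans by blast
  obtain k where k: "strict_mono (k :: nat \<Rightarrow> nat)"
    and kS: "\<And>x. x \<in> S \<Longrightarrow> \<exists>l. (\<lambda>n. blinfun_apply (f (k n)) x / (1 + norm x)) \<longlonglongrightarrow> l"
  \<comment> \<open>The diagonal argument asks for one bound valid at all points, which division by
    \<open>1 + norm x\<close> provides.\<close>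
  proof (rule function_convergent_subsequence[OF S(1), of "\<lambda>n x. blinfun_apply (f n) x / (1 + norm x)" M])
    fix n x
    have "norm (blinfun_apply (f n) x) \<le> M * (1 + norm x)"
      using bd[of n x] M0 by (simp add: algebra_simps)
    then show "norm (blinfun_apply (f n) x / (1 + norm x)) \<le> M"
      by (simp add: divide_le_eq add_pos_nonneg)
  qed blast
  have "convergent (\<lambda>n. blinfun_apply (f (k n)) x)" for x
  proof -
    have "Cauchy (\<lambda>n. blinfun_apply (f (k n)) x)"
    proof (rule metric_CauchyI)
      fix e :: real assume e: "e > 0"
      \<comment> \<open>The denominator \<open>M + 1\<close> stays positive when
        \<open>M = 0\<close>. Replacing \<open>x\<close> by \<open>y\<close> then costs at most
        \<open>e / 4\<close> in each of two terms.\<close>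
      define d where "d = (e / 4) / (M + 1)"
      have "d > 0" using e M0 by (simp add: d_def)
      then obtain y where y: "y \<in> S" "dist y x < d"
        using S(2) closure_approachable[of x S] by auto
      have Md: "M * norm (x - y) \<le> e / 4"
      proof -
        have "M * norm (x - y) \<le> (M + 1) * d"
          using y M0 by (intro mult_mono) (auto simp: dist_norm norm_minus_commute)
        also have "\<dots> = e / 4" unfolding d_def using M0
          by (metis add_nonneg_eq_0_iff nonzero_mult_div_cancel_left times_divide_eq_right zero_le_one zero_neq_one)
        finally show ?thesis .
      qed
      obtain l where "(\<lambda>n. blinfun_apply (f (k n)) y / (1 + norm y)) \<longlonglongrightarrow> l" using kS[OF y(1)] by blast
      then have "(\<lambda>n. blinfun_apply (f (k n)) y / (1 + norm y) * (1 + norm y)) \<longlonglongrightarrow> l * (1 + norm y)"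
        by (intro tendsto_intros)
      moreover have "1 + norm y \<noteq> 0" by (smt (verit) norm_ge_zero)
      ultimately have "(\<lambda>n. blinfun_apply (f (k n)) y) \<longlonglongrightarrow> l * (1 + norm y)"
        by simp
      then have "Cauchy (\<lambda>n. blinfun_apply (f (k n)) y)" using LIMSEQ_imp_Cauchy by blast
      then obtain N where N: "\<And>m n. m \<ge> N \<Longrightarrow> n \<ge> N \<Longrightarrow>
          dist (blinfun_apply (f (k m)) y) (blinfun_apply (f (k n)) y) < e / 4"
        using e metric_CauchyD[of _ "e / 4"] by (metis zero_less_divide_iff zero_less_numeral)
      have "dist (blinfun_apply (f (k m)) x) (blinfun_apply (f (k n)) x) < e" if "m \<ge> N" "n \<ge> N" for m n
        using N[OF that] bd[of "k m" "x - y"] bd[of "k n" "x - y"] Md e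
        unfolding dist_norm blinfun.diff_right real_norm_def by linarith
      then show "\<exists>N. \<forall>m\<ge>N. \<forall>n\<ge>N. dist (blinfun_apply (f (k m)) x) (blinfun_apply (f (k n)) x) < e"
        by blast
    qed
    then show ?thesis by (rule Cauchy_convergent)
  qed
  then obtain g where g: "\<And>x. (\<lambda>n. blinfun_apply (f (k n)) x) \<longlonglongrightarrow> g x"
    unfolding convergent_def by metis
  have "bounded_linear g"
  proof (rule bounded_linear_intro[where K=M])
    show "g (x + y) = g x + g y" for x y
      using LIMSEQ_unique[OF g[of "x + y"]] tendsto_add[OF g[of x] g[of y]] by (simp add: blinfun.add_right)
    show "g (c *\<^sub>R x) = c *\<^sub>R g x" for c x
      using LIMSEQ_unique[OF g[of "c *\<^sub>R x"]] tendsto_scaleR[OF tendsto_const g[of x]]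
      by (simp add: blinfun.scaleR_right)
    show "norm (g x) \<le> norm x * M" for x
      by (rule LIMSEQ_le_const2[OF tendsto_norm[OF g[of x]]]) (use bd[of _ x] in \<open>auto simp: mult.commute\<close>)
  qed
  then show ?thesis using k g by (metis bounded_linear_Blinfun_apply)
qed

section \<open>Cylinder laws and barycenters\<close>

locale cylinder_law =
  fixes \<mu> :: "'a::banach set \<Rightarrow> real" and P :: "'w measure" and X :: "'a dual \<Rightarrow> 'w \<Rightarrow> real"
  assumes reflexive: "reflexive_space TYPE('a)"
    and cylinder: "cylinder_prob_measure1 \<mu>"
    and random_element: "generalized_random_element P X"
    and law: "has_cylinder_law P X \<mu>"
begin

sublocale prob_space P
  using random_element by (simp add: generalized_random_element_def)

lemma integrable_X [simp, intro]: "integrable P (X f)"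
  and X_add: "AE \<omega> in P. X (f + g) \<omega> = X f \<omega> + X g \<omega>"
  and X_scaleR: "AE \<omega> in P. X (c *\<^sub>R f) \<omega> = c * X f \<omega>"
  using random_element by (auto simp: generalized_random_element_def)

lemma measurable_X [measurable, simp]: "X f \<in> borel_measurable P"
  by (rule borel_measurable_integrable) simp

lemma X_zero: "AE \<omega> in P. X 0 \<omega> = 0"
  using X_scaleR[of 0 0] by simp

lemma X_uminus: "AE \<omega> in P. X (- f) \<omega> = - X f \<omega>"
  using X_scaleR[of "-1" f] by simp

definition tuple_event :: "nat \<Rightarrow> (nat \<Rightarrow> 'a dual) \<Rightarrow> (nat \<Rightarrow> real) set \<Rightarrow> 'w set" where
  "tuple_event m fs B = {\<omega> \<in> space P. (\<lambda>i\<in>{..<m}. X (fs i) \<omega>) \<in> B}"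

lemma measurable_X_tuple [measurable]:
  "(\<lambda>\<omega>. \<lambda>i\<in>{..<m}. X (fs i) \<omega>) \<in> measurable P (\<Pi>\<^sub>M i\<in>{..<m}. borel)"
  by (rule measurable_restrict) simp

lemma tuple_event_sets [measurable]:
  "B \<in> sets (\<Pi>\<^sub>M i\<in>{..<m}. borel) \<Longrightarrow> tuple_event m fs B \<in> sets P"
  using measurable_sets[OF measurable_X_tuple, of B m fs]
  by (simp add: tuple_event_def vimage_def Int_def conj_commute)

lemma cylinder_measure_eq_prob:
  assumes m: "m \<ge> 1" and B: "B \<in> sets (\<Pi>\<^sub>M i\<in>{..<m}. (borel :: real measure))"
  shows "\<mu> {x. tuple_map m fs x \<in> B} = prob (tuple_event m fs B)"
proof -
  have A: "tuple_map m fs -` B \<in> tuple_algebra m fs"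
    using measurable_sets[OF measurable_tuple_map B, of fs \<mu>] by simp
  have "ennreal (\<mu> (tuple_map m fs -` B)) =
      emeasure (distr (tuple_measure \<mu> m fs) (\<Pi>\<^sub>M i\<in>{..<m}. borel) (tuple_map m fs)) B"
    using B A m by (simp add: emeasure_distr[OF measurable_tuple_map] emeasure_tuple_measure[OF cylinder])
  also have "\<dots> = emeasure (distr P (\<Pi>\<^sub>M i\<in>{..<m}. borel) (\<lambda>\<omega>. \<lambda>i\<in>{..<m}. X (fs i) \<omega>)) B"
    using law m by (simp add: has_cylinder_law_def)
  also have "\<dots> = ennreal (prob (tuple_event m fs B))"
    using B by (simp add: emeasure_distr emeasure_eq_measure tuple_event_def vimage_def Int_def conj_commute)
  finally have eq: "ennreal (\<mu> (tuple_map m fs -` B)) = ennreal (prob (tuple_event m fs B))" .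
  \<comment> \<open>Since \<open>ennreal\<close> sends negative reals to 0, nonnegativity of \<mu>
    on cylinders is needed to cancel it.\<close>
  have "tuple_map m fs -` B \<in> cylinder_sets" unfolding cylinder_sets_eq using A m by auto
  then have "\<mu> (tuple_map m fs -` B) \<ge> 0" using cylinder by (auto simp: cylinder_prob_measure1_def)
  then show ?thesis using eq by (simp add: vimage_def)
qed

text \<open>The integrand involves \<open>f\<close> besides the functionals \<open>fs\<close>.
  Appending \<open>f\<close> at index \<open>m\<close> makes it a Borel function \<open>h\<close> of
  one longer tuple, and both sides integrate \<open>h\<close> against the same law.\<close>

lemma cylinder_integral_eq_expectation:
  assumes m: "m \<ge> 1" and B: "B \<in> sets (\<Pi>\<^sub>M i\<in>{..<m}. (borel :: real measure))"
  shows "cylinder_integral \<mu> (\<lambda>x. indicator {x. tuple_map m fs x \<in> B} x * blinfun_apply f x)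
    = expectation (\<lambda>\<omega>. indicator (tuple_event m fs B) \<omega> * X f \<omega>)"
proof -
  define gs where "gs = fs(m := f)"
  define h where "h w = indicator B (restrict w {..<m}) * w m" for w :: "nat \<Rightarrow> real"
  let ?N = "\<Pi>\<^sub>M i\<in>{..<Suc m}. (borel :: real measure)"
  have [measurable]: "(\<lambda>w. restrict w {..<m}) \<in> measurable ?N (\<Pi>\<^sub>M i\<in>{..<m}. borel)"
    by (rule measurable_restrict_subset) auto
  have [measurable]: "(\<lambda>w. w m) \<in> borel_measurable ?N"
    by (rule measurable_component_singleton) simp
  have h: "h \<in> borel_measurable ?N" unfolding h_def using B by measurable
  have res: "restrict (tuple_map (Suc m) gs x) {..<m} = tuple_map m fs x" for x
    by (auto simp: tuple_map_def gs_def fun_eq_iff)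
  have resX: "restrict (\<lambda>i\<in>{..<Suc m}. X (gs i) \<omega>) {..<m} = (\<lambda>i\<in>{..<m}. X (fs i) \<omega>)" for \<omega>
    by (auto simp: gs_def fun_eq_iff)
  have hx: "indicator {x. tuple_map m fs x \<in> B} x * blinfun_apply f x = h (tuple_map (Suc m) gs x)" for x
    unfolding h_def res by (simp add: tuple_map_def gs_def indicator_def)
  have "cylinder_integral \<mu> (\<lambda>x. h (tuple_map (Suc m) gs x)) =
      (\<integral>x. h (tuple_map (Suc m) gs x) \<partial>tuple_measure \<mu> (Suc m) gs)"
    by (rule cylinder_integral_eq[OF cylinder _ measurable_compose[OF measurable_tuple_map h]]) simp
  also have "\<dots> = (\<integral>w. h w \<partial>distr (tuple_measure \<mu> (Suc m) gs) ?N (tuple_map (Suc m) gs))"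
    by (rule integral_distr[OF measurable_tuple_map h, symmetric])
  also have "\<dots> = (\<integral>w. h w \<partial>distr P ?N (\<lambda>\<omega>. \<lambda>i\<in>{..<Suc m}. X (gs i) \<omega>))"
    using law by (simp add: has_cylinder_law_def)
  also have "\<dots> = expectation (\<lambda>\<omega>. h (\<lambda>i\<in>{..<Suc m}. X (gs i) \<omega>))"
    by (rule integral_distr[OF measurable_X_tuple h])
  also have "\<dots> = expectation (\<lambda>\<omega>. indicator (tuple_event m fs B) \<omega> * X f \<omega>)"
  proof (rule Bochner_Integration.integral_cong[OF refl])
    fix \<omega> assume "\<omega> \<in> space P"
    then show "h (\<lambda>i\<in>{..<Suc m}. X (gs i) \<omega>) = indicator (tuple_event m fs B) \<omega> * X f \<omega>"
      unfolding h_def resX by (simp add: tuple_event_def gs_def indicator_def)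
  qed
  finally show ?thesis by (simp add: hx)
qed

lemma integrable_weighted:
  assumes [measurable]: "\<eta> \<in> borel_measurable P" and "\<And>\<omega>. \<omega> \<in> space P \<Longrightarrow> \<bar>\<eta> \<omega>\<bar> \<le> 1"
    and Z: "integrable P Z"
  shows "integrable P (\<lambda>\<omega>. \<eta> \<omega> * (Z \<omega> :: real))"
proof (rule Bochner_Integration.integrable_bound[OF Z])
  have [measurable]: "Z \<in> borel_measurable P" using Z by simp
  show "(\<lambda>\<omega>. \<eta> \<omega> * Z \<omega>) \<in> borel_measurable P" by measurable
  show "AE \<omega> in P. norm (\<eta> \<omega> * Z \<omega>) \<le> norm (Z \<omega>)"
    using assms(2) by (auto intro!: AE_I2 simp: abs_mult mult_left_le_one_le)
qed

text \<open>Taking expectations turns the almost sure linearity of \<open>X\<close> into exact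
  linearity in \<open>f\<close>. With the first-moment bound this is an element of the bidual, and
  reflexivity represents it by a point.\<close>

lemma ex_weighted_mean:
  assumes \<eta> [measurable]: "\<eta> \<in> borel_measurable P"
    and \<eta>_le: "\<And>\<omega>. \<omega> \<in> space P \<Longrightarrow> \<bar>\<eta> \<omega>\<bar> \<le> 1"
  shows "\<exists>y. \<forall>f. blinfun_apply f y = expectation (\<lambda>\<omega>. \<eta> \<omega> * X f \<omega>)"
proof -
  let ?\<phi> = "\<lambda>f. expectation (\<lambda>\<omega>. \<eta> \<omega> * X f \<omega>)"
  obtain C where C: "\<And>f. expectation (\<lambda>\<omega>. \<bar>X f \<omega>\<bar>) \<le> C * norm f"
    using random_element by (auto simp: generalized_random_element_def)
  have int: "integrable P (\<lambda>\<omega>. \<eta> \<omega> * X f \<omega>)" for f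
    by (rule integrable_weighted) (use \<eta>_le in auto)
  have "bounded_linear ?\<phi>"
  proof (rule bounded_linear_intro[where K=C])
    fix f g
    have "?\<phi> (f + g) = expectation (\<lambda>\<omega>. \<eta> \<omega> * X f \<omega> + \<eta> \<omega> * X g \<omega>)"
      by (rule integral_cong_AE; (measurable)?) (use X_add[of f g] in eventually_elim, simp add: distrib_left)
    then show "?\<phi> (f + g) = ?\<phi> f + ?\<phi> g" using int by simp
  next
    fix c f
    have "?\<phi> (c *\<^sub>R f) = expectation (\<lambda>\<omega>. c * (\<eta> \<omega> * X f \<omega>))"
      by (rule integral_cong_AE; (measurable)?) (use X_scaleR[of c f] in eventually_elim, simp)
    then show "?\<phi> (c *\<^sub>R f) = c *\<^sub>R ?\<phi> f" by simp
  next
    fix f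
    have "norm (?\<phi> f) \<le> expectation (\<lambda>\<omega>. norm (\<eta> \<omega> * X f \<omega>))" by (rule integral_norm_bound)
    also have "\<dots> \<le> expectation (\<lambda>\<omega>. \<bar>X f \<omega>\<bar>)"
      by (rule integral_mono[OF integrable_norm[OF int]])
        (use \<eta>_le in \<open>auto simp: abs_mult mult_left_le_one_le\<close>)
    finally show "norm (?\<phi> f) \<le> norm f * C" using C[of f] by (simp add: mult.commute)
  qed
  then have "blinfun_apply (Blinfun ?\<phi>) = ?\<phi>" by (rule bounded_linear_Blinfun_apply)
  then show ?thesis using reflexive unfolding reflexive_space_def by metis
qed

lemma weighted_mean_apply:
  assumes "\<eta> \<in> borel_measurable P" and "\<And>\<omega>. \<omega> \<in> space P \<Longrightarrow> \<bar>\<eta> \<omega>\<bar> \<le> 1"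
  shows "blinfun_apply f (weighted_mean P X \<eta>) = expectation (\<lambda>\<omega>. \<eta> \<omega> * X f \<omega>)"
proof -
  obtain y where y: "\<And>f. blinfun_apply f y = expectation (\<lambda>\<omega>. \<eta> \<omega> * X f \<omega>)"
    using ex_weighted_mean assms by metis
  have "weighted_mean P X \<eta> = y"
    unfolding weighted_mean_def by (rule the_equality) (auto simp: y intro: dual_ext)
  then show ?thesis using y by simp
qed

lemma barycenter_apply:
  assumes "m \<ge> 1" and B: "B \<in> sets (\<Pi>\<^sub>M i\<in>{..<m}. (borel :: real measure))"
  shows "blinfun_apply f (barycenter \<mu> {x. tuple_map m fs x \<in> B}) =
    (1 / prob (tuple_event m fs B)) * expectation (\<lambda>\<omega>. indicator (tuple_event m fs B) \<omega> * X f \<omega>)"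
proof -
  obtain y where y: "\<And>f. blinfun_apply f y = expectation (\<lambda>\<omega>. indicator (tuple_event m fs B) \<omega> * X f \<omega>)"
    using ex_weighted_mean[of "indicator (tuple_event m fs B)"] B by (auto simp: indicator_def)
  have "(THE y. \<forall>f. blinfun_apply f y = expectation (\<lambda>\<omega>. indicator (tuple_event m fs B) \<omega> * X f \<omega>)) = y"
    by (rule the_equality) (auto simp: y intro: dual_ext)
  then show ?thesis
    unfolding barycenter_def cylinder_integral_eq_expectation[OF assms] cylinder_measure_eq_prob[OF assms]
    by (simp add: blinfun.scaleR_right y)
qed

lemma barycenter_event:
  assumes "A \<in> cylinder_sets"
  obtains E where "E \<in> events" "\<mu> A = prob E"
    "\<And>f. blinfun_apply f (barycenter \<mu> A) = (1 / prob E) * expectation (\<lambda>\<omega>. indicator E \<omega> * X f \<omega>)"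
proof -
  obtain m fs B where A: "A = {x. tuple_map m fs x \<in> B}" "m \<ge> 1"
      "B \<in> sets (\<Pi>\<^sub>M i\<in>{..<m}. (borel :: real measure))"
    using assms by (auto simp: cylinder_sets_def)
  show thesis
    by (rule that[of "tuple_event m fs B"])
      (use A in \<open>simp_all add: cylinder_measure_eq_prob barycenter_apply tuple_event_sets\<close>)
qed

lemma marginal_set:
  assumes [measurable]: "D \<in> sets (borel :: real measure)"
  defines "B \<equiv> {w \<in> space (\<Pi>\<^sub>M i\<in>{..<1::nat}. (borel :: real measure)). w 0 \<in> D}"
  shows "B \<in> sets (\<Pi>\<^sub>M i\<in>{..<1::nat}. (borel :: real measure))"
    and "{x. blinfun_apply (f :: 'a dual) x \<in> D} = {x. tuple_map 1 (\<lambda>_. f) x \<in> B}"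
    and "tuple_event 1 (\<lambda>_. f) B = {\<omega> \<in> space P. X f \<omega> \<in> D}"
proof -
  have [measurable]: "(\<lambda>w. w 0) \<in> borel_measurable (\<Pi>\<^sub>M i\<in>{..<1::nat}. (borel :: real measure))"
    by (rule measurable_component_singleton) simp
  show "B \<in> sets (\<Pi>\<^sub>M i\<in>{..<1::nat}. (borel :: real measure))" unfolding B_def by measurable
qed (auto simp: B_def tuple_map_def tuple_event_def space_PiM)

lemma marginal_measure:
  assumes "D \<in> sets borel"
  shows "\<mu> {x. blinfun_apply f x \<in> D} = prob {\<omega> \<in> space P. X f \<omega> \<in> D}"
  unfolding marginal_set(2)[OF assms] marginal_set(3)[OF assms, symmetric]
  by (rule cylinder_measure_eq_prob[OF _ marginal_set(1)[OF assms]]) simp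

lemma marginal_cylinder:
  fixes f :: "'a dual"
  assumes "D \<in> sets borel"
  shows "{x. blinfun_apply f x \<in> D} \<in> cylinder_sets"
  unfolding marginal_set(2)[OF assms] cylinder_sets_def using marginal_set(1)[OF assms] by blast

lemma barycenter_marginal_apply:
  assumes "D \<in> sets borel"
  shows "blinfun_apply g (barycenter \<mu> {x. blinfun_apply f x \<in> D}) =
    (1 / prob {\<omega> \<in> space P. X f \<omega> \<in> D}) *
      expectation (\<lambda>\<omega>. indicator {\<omega> \<in> space P. X f \<omega> \<in> D} \<omega> * X g \<omega>)"
  unfolding marginal_set(2)[OF assms] marginal_set(3)[OF assms, symmetric]
  by (rule barycenter_apply[OF _ marginal_set(1)[OF assms]]) simp

lemma halfspace_cylinder: "(H :: 'a set) \<in> halfspaces \<Longrightarrow> H \<in> cylinder_sets"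
  using marginal_cylinder[OF borel_closed[OF closed_atLeast]] by (auto simp: halfspaces_def)

lemma halfspace_measure: "\<mu> {x. blinfun_apply f x \<ge> a} = prob {\<omega> \<in> space P. X f \<omega> \<ge> a}"
  using marginal_measure[of "{a..}" f] by simp

lemma barycenter_halfspace_apply:
  "blinfun_apply g (barycenter \<mu> {x. blinfun_apply f x \<ge> a}) =
    (1 / prob {\<omega> \<in> space P. X f \<omega> \<ge> a}) * expectation (\<lambda>\<omega>. indicator {\<omega> \<in> space P. X f \<omega> \<ge> a} \<omega> * X g \<omega>)"
  using barycenter_marginal_apply[of "{a..}" g f] by simp

text \<open>The marginal laws of \<open>X f\<close> and \<open>X g\<close> do not determine this
  quantity, so the pair is treated as a tuple of length two.\<close>

lemma sym_diff_halfspaces_measure: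
  "\<mu> (sym_diff {x. blinfun_apply f x \<ge> a} {x. blinfun_apply g x \<ge> b}) =
    prob (sym_diff {\<omega> \<in> space P. X f \<omega> \<ge> a} {\<omega> \<in> space P. X g \<omega> \<ge> b})"
proof -
  let ?N = "\<Pi>\<^sub>M i\<in>{..<2::nat}. (borel :: real measure)"
  define fs where "fs i = (if i = 0 then f else g)" for i :: nat
  define B where "B = {w \<in> space ?N. (w 0 \<ge> a) \<noteq> (w 1 \<ge> b)}"
  have [measurable]: "(\<lambda>w. w i) \<in> borel_measurable ?N" if "i < 2" for i
    using that by (intro measurable_component_singleton) simp
  have B: "B \<in> sets ?N" unfolding B_def by measurable
  have "sym_diff {x. blinfun_apply f x \<ge> a} {x. blinfun_apply g x \<ge> b} = {x. tuple_map 2 fs x \<in> B}"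
    by (auto simp: B_def tuple_map_def space_PiM fs_def)
  moreover have "sym_diff {\<omega> \<in> space P. X f \<omega> \<ge> a} {\<omega> \<in> space P. X g \<omega> \<ge> b} = tuple_event 2 fs B"
    by (auto simp: B_def tuple_event_def space_PiM fs_def)
  ultimately show ?thesis using cylinder_measure_eq_prob[OF _ B] by simp
qed

section \<open>Expected positive parts\<close>

text \<open>\<open>gain x 1\<close> is the objective of the linear programme dual to maximising \<open>E \<eta>\<close> over
  \<open>0 \<le> \<eta> \<le> 1\<close> subject to \<open>E (\<eta> (X - x)) = 0\<close>; \<open>gain x 0\<close> is its recession function.\<close>

definition gain :: "'a \<Rightarrow> real \<Rightarrow> 'a dual \<Rightarrow> real" where
  "gain x k f = expectation (\<lambda>\<omega>. max 0 (k + X f \<omega> - blinfun_apply f x))"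

lemma gain_nonneg: "gain x k f \<ge> 0"
  unfolding gain_def by (rule integral_nonneg_AE) auto

lemma gain_mono: "k \<le> l \<Longrightarrow> gain x k f \<le> gain x l f"
  unfolding gain_def by (rule integral_mono) auto

text \<open>The positive part is 1-Lipschitz.\<close>

lemma gain_change_point: "gain y k f \<le> gain x k f + \<bar>blinfun_apply f (x - y)\<bar>"
proof -
  have "gain y k f \<le> expectation (\<lambda>\<omega>. max 0 (k + X f \<omega> - blinfun_apply f x) + \<bar>blinfun_apply f (x - y)\<bar>)"
    unfolding gain_def by (rule integral_mono) (auto simp: blinfun.diff_right)
  then show ?thesis by (simp add: gain_def prob_space)
qed

lemma gain_scaleR:
  assumes "c \<ge> 0" shows "gain x 0 (c *\<^sub>R f) = c * gain x 0 f"
proof -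
  have "gain x 0 (c *\<^sub>R f) = expectation (\<lambda>\<omega>. c * max 0 (0 + X f \<omega> - blinfun_apply f x))"
    unfolding gain_def
  proof (rule integral_cong_AE)
    show "AE \<omega> in P. max 0 (0 + X (c *\<^sub>R f) \<omega> - blinfun_apply (c *\<^sub>R f) x) =
        c * max 0 (0 + X f \<omega> - blinfun_apply f x)"
      using X_scaleR[of c f] by eventually_elim (use assms in \<open>simp add: max_mult_distrib_left blinfun.scaleR_left algebra_simps\<close>)
  qed measurable
  then show ?thesis by (simp add: gain_def)
qed

lemma gain_zero_iff: "gain x k f = 0 \<longleftrightarrow> (AE \<omega> in P. X f \<omega> \<le> blinfun_apply f x - k)"
proof -
  have "gain x k f = 0 \<longleftrightarrow> (AE \<omega> in P. max 0 (k + X f \<omega> - blinfun_apply f x) = 0)"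
    unfolding gain_def by (rule integral_nonneg_eq_0_iff_AE) auto
  also have "\<dots> \<longleftrightarrow> (AE \<omega> in P. X f \<omega> \<le> blinfun_apply f x - k)"
    by (rule AE_cong) auto
  finally show ?thesis .
qed

text \<open>For fixed \<open>0 \<le> \<eta> \<le> 1\<close> the function \<open>J f = E (\<eta> (k + X f - f x))\<close> is a lower bound for
  \<open>gain x k\<close> and, since \<open>E (\<eta> X)\<close> is a point of the space by reflexivity, weak* continuous;
  it is attained at \<open>f\<close> when \<open>\<eta>\<close> is the indicator of the positive part.\<close>

lemma gain_weakstar_lsc:
  assumes lim: "\<And>y. (\<lambda>n. blinfun_apply (h n) y) \<longlonglongrightarrow> blinfun_apply f y"
    and le: "\<And>n. gain x k (h n) \<le> M n" and M: "M \<longlonglongrightarrow> L"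
  shows "gain x k f \<le> L"
proof -
  define E where "E = {\<omega> \<in> space P. 0 < k + X f \<omega> - blinfun_apply f x}"
  have E [measurable]: "E \<in> sets P" unfolding E_def by measurable
  obtain y where y: "\<And>g. blinfun_apply g y = expectation (\<lambda>\<omega>. indicator E \<omega> * X g \<omega>)"
    using ex_weighted_mean[of "indicator E"] by (auto simp: indicator_def)
  define J where "J g = (k - blinfun_apply g x) * prob E + blinfun_apply g y" for g
  have J: "J g = expectation (\<lambda>\<omega>. indicator E \<omega> * (k + X g \<omega> - blinfun_apply g x))" for g
  proof -
    have "integrable P (\<lambda>\<omega>. indicator E \<omega> * X g \<omega>)"
      by (rule integrable_weighted) (auto simp: indicator_def)
    moreover have "integrable P (\<lambda>\<omega>. (k - blinfun_apply g x) * indicator E \<omega>)"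
      by (simp add: emeasure_eq_measure)
    ultimately have "expectation (\<lambda>\<omega>. (k - blinfun_apply g x) * indicator E \<omega> + indicator E \<omega> * X g \<omega>) = J g"
      by (subst Bochner_Integration.integral_add) (simp_all add: J_def y)
    then show ?thesis by (simp add: algebra_simps)
  qed
  have "J g \<le> gain x k g" for g
    unfolding J gain_def
    by (rule integral_mono) (auto simp: indicator_def intro!: integrable_weighted)
  then have "J (h n) \<le> M n" for n using le order_trans by blast
  moreover have "(\<lambda>n. J (h n)) \<longlonglongrightarrow> J f"
    unfolding J_def by (intro tendsto_intros lim)
  ultimately have "J f \<le> L" by (intro LIMSEQ_le[OF _ M]) auto
  moreover have "gain x k f = J f"
    unfolding J gain_def by (rule Bochner_Integration.integral_cong) (auto simp: E_def indicator_def)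
  ultimately show ?thesis by simp
qed

section \<open>Coercivity and the support hull\<close>

text \<open>As \<open>gain x 0\<close> is positively homogeneous, this is a uniform positive lower
  bound on the unit sphere of the dual. By \<open>gain_mono\<close> it also makes the sublevel sets
  of \<open>gain x 1\<close> norm bounded.\<close>

definition coercive_at :: "'a \<Rightarrow> real \<Rightarrow> bool" where
  "coercive_at x c \<longleftrightarrow> c > 0 \<and> (\<forall>f. c * norm f \<le> gain x 0 f)"

text \<open>If \<open>z\<close> is the mean with weight \<eta> of total mass \<alpha>, then \<alpha>
  times the left side is the expectation of \<eta> times \<open>X f - f x\<close>, at most that of
  the positive part because \<eta> lies between 0 and 1. The constant is the reciprocal of \<alpha>,
  so it depends on \<open>z\<close>.\<close>

lemma trimmed_region0_gain:
  assumes "z \<in> trimmed_region0 P X"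
  shows "\<exists>c\<ge>0. \<forall>f. blinfun_apply f (z - x) \<le> c * gain x 0 f"
proof -
  obtain \<alpha> \<eta> where \<alpha>: "0 < \<alpha>" and z: "z = (1 / \<alpha>) *\<^sub>R weighted_mean P X \<eta>"
    and \<eta>: "\<eta> \<in> borel_measurable (generated_algebra P X)"
    and \<eta>01: "\<And>\<omega>. \<omega> \<in> space P \<Longrightarrow> 0 \<le> \<eta> \<omega> \<and> \<eta> \<omega> \<le> 1"
    and mean: "expectation \<eta> = \<alpha>"
    using assms by (auto simp: trimmed_region0_def trimmed_region_def)
  have "subalgebra P (generated_algebra P X)"
  proof -
    have sub: "{X f -` B \<inter> space P |f B. B \<in> sets borel} \<subseteq> sets P"
      by (auto intro: measurable_sets[OF measurable_X])
    then have "{X f -` B \<inter> space P |f B. B \<in> sets borel} \<subseteq> Pow (space P)"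
      using sets.sets_into_space by blast
    then show ?thesis
      using sets.sigma_sets_subset[OF sub] by (simp add: subalgebra_def generated_algebra_def)
  qed
  then have \<eta>P [measurable]: "\<eta> \<in> borel_measurable P"
    using \<eta> by (rule measurable_from_subalg)
  have \<eta>_le: "\<bar>\<eta> \<omega>\<bar> \<le> 1" if "\<omega> \<in> space P" for \<omega> using \<eta>01[OF that] by auto
  have "blinfun_apply f (z - x) \<le> (1 / \<alpha>) * gain x 0 f" for f
  proof -
    have "integrable P (\<lambda>\<omega>. \<eta> \<omega> * X f \<omega>)" "integrable P (\<lambda>\<omega>. \<eta> \<omega> * 1)"
      by (rule integrable_weighted; use \<eta>_le in simp)+
    then have "expectation (\<lambda>\<omega>. \<eta> \<omega> * X f \<omega> - blinfun_apply f x * \<eta> \<omega>) =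
        blinfun_apply f (weighted_mean P X \<eta>) - blinfun_apply f x * \<alpha>"
      by (subst Bochner_Integration.integral_diff) (simp_all add: weighted_mean_apply \<eta>_le mean)
    also have "\<dots> = \<alpha> * blinfun_apply f (z - x)"
      using \<alpha> by (simp add: z blinfun.diff_right blinfun.scaleR_right field_simps)
    finally have eq: "expectation (\<lambda>\<omega>. \<eta> \<omega> * (X f \<omega> - blinfun_apply f x)) = \<alpha> * blinfun_apply f (z - x)"
      by (simp add: algebra_simps)
    have "expectation (\<lambda>\<omega>. \<eta> \<omega> * (X f \<omega> - blinfun_apply f x)) \<le> gain x 0 f"
      unfolding gain_def
    proof (rule integral_mono)
      show "integrable P (\<lambda>\<omega>. \<eta> \<omega> * (X f \<omega> - blinfun_apply f x))"
        by (rule integrable_weighted) (use \<eta>_le in auto)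
      fix \<omega> assume \<omega>: "\<omega> \<in> space P"
      have "\<eta> \<omega> * (X f \<omega> - blinfun_apply f x) \<le> \<eta> \<omega> * max 0 (X f \<omega> - blinfun_apply f x)"
        using \<eta>01[OF \<omega>] by (intro mult_left_mono) auto
      also have "\<dots> \<le> max 0 (X f \<omega> - blinfun_apply f x)"
        using \<eta>01[OF \<omega>] by (intro mult_left_le_one_le) auto
      finally show "\<eta> \<omega> * (X f \<omega> - blinfun_apply f x) \<le> max 0 (0 + X f \<omega> - blinfun_apply f x)" by simp
    qed simp
    then show ?thesis using eq \<alpha> by (simp add: field_simps)
  qed
  then show ?thesis using \<alpha> by (intro exI[of _ "1 / \<alpha>"]) simp
qed

text \<open>The lower bounds for \<open>gain x 0\<close> obtained from single points of a ball around \<open>x\<close> have no common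
  constant; the uniform one comes from the uniform boundedness principle.\<close>

lemma ex_coercive:
  assumes "interior (trimmed_region0 P X) \<noteq> {}"
  shows "\<exists>x c. coercive_at x c"
proof -
  obtain x r where r: "r > 0" "ball x r \<subseteq> trimmed_region0 P X"
    using assms by (metis all_not_in_conv interior_subset open_contains_ball open_interior subset_trans)
  define K where "K = {f. gain x 0 f \<le> 1}"
  have up: "\<exists>M. \<forall>f\<in>K. blinfun_apply f u \<le> M" for u
  proof (cases "u = 0")
    case False
    define s where "s = r / 2 / norm u"
    have s: "s > 0" using r False by (simp add: s_def)
    have "x + s *\<^sub>R u \<in> ball x r" using r False by (simp add: s_def dist_norm)
    then obtain c where c: "c \<ge> 0" "\<And>f. blinfun_apply f ((x + s *\<^sub>R u) - x) \<le> c * gain x 0 f"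
      using trimmed_region0_gain r(2) by blast
    have "blinfun_apply f u \<le> c / s" if "f \<in> K" for f
    proof -
      have "s * blinfun_apply f u \<le> c * gain x 0 f" using c(2)[of f] by (simp add: blinfun.scaleR_right)
      also have "\<dots> \<le> c * 1" using that c(1) by (intro mult_left_mono) (auto simp: K_def)
      finally show ?thesis using s by (simp add: field_simps)
    qed
    then show ?thesis by blast
  qed auto
  have "\<exists>M. \<forall>f\<in>K. norm (blinfun_apply f u) \<le> M" for u
  proof -
    obtain M1 M2 where M: "\<And>f. f \<in> K \<Longrightarrow> blinfun_apply f u \<le> M1" "\<And>f. f \<in> K \<Longrightarrow> blinfun_apply f (- u) \<le> M2"
      using up[of u] up[of "- u"] by blast
    have "norm (blinfun_apply f u) \<le> max M1 M2" if "f \<in> K" for f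
      using M[OF that] by (simp add: blinfun.minus_right)
    then show ?thesis by blast
  qed
  from uniform_boundedness[OF this] obtain M where M: "\<And>f. f \<in> K \<Longrightarrow> norm f \<le> M" by blast
  define L where "L = max M 1"
  have L: "L > 0" "\<And>f. f \<in> K \<Longrightarrow> norm f \<le> L" using M by (fastforce simp: L_def)+
  have "norm f \<le> L * gain x 0 f" for f
  proof (rule field_le_epsilon)
    fix e :: real assume e: "e > 0"
    \<comment> \<open>At this stage \<open>gain x 0 f\<close> might vanish; the summand
      \<open>e / L\<close> permits dividing by \<open>s\<close> and contributes exactly
      \<open>e\<close> at the end.\<close>
    define s where "s = gain x 0 f + e / L"
    have s: "s > 0" "gain x 0 f \<le> s" using e L gain_nonneg[of x 0 f] by (auto simp: s_def add_nonneg_pos)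
    have "(1 / s) *\<^sub>R f \<in> K" using s by (simp add: K_def gain_scaleR)
    then have "norm f / s \<le> L" using L(2) s by fastforce
    then have "norm f \<le> L * s" using s by (simp add: field_simps)
    also have "\<dots> = L * gain x 0 f + e" using L by (simp add: s_def algebra_simps)
    finally show "norm f \<le> L * gain x 0 f + e" .
  qed
  then have "coercive_at x (1 / L)" using L by (simp add: coercive_at_def field_simps)
  then show ?thesis by blast
qed

text \<open>Unit functionals violating coercivity at \<open>x\<close> have a weak* limit \<open>f\<close> with \<open>gain x 0 f = 0\<close>, so
  \<open>f = 0\<close> by strictness. But then their values at \<open>x - y\<close> tend to zero, which contradicts
  coercivity at \<open>y\<close>.\<close>

lemma coercive_at_change_point:
  assumes sep: "separable_space (euclidean :: 'a topology)"
    and y: "coercive_at y d"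
    and strict: "\<And>f. f \<noteq> 0 \<Longrightarrow> \<not> (AE \<omega> in P. X f \<omega> \<le> blinfun_apply f x)"
  shows "\<exists>c. coercive_at x c"
proof (rule ccontr)
  assume no: "\<not> ?thesis"
  have "\<exists>f. norm f = 1 \<and> gain x 0 f < 1 / real (Suc n)" for n
  proof -
    have "\<not> coercive_at x (1 / real (Suc n))" using no by blast
    then obtain f where f: "gain x 0 f < 1 / real (Suc n) * norm f"
      unfolding coercive_at_def by (auto simp: not_le)
    have "f \<noteq> 0"
    proof
      assume "f = 0"
      then show False using f gain_nonneg[of x 0 f] by simp
    qed
    then have "norm ((1 / norm f) *\<^sub>R f) = 1 \<and> gain x 0 ((1 / norm f) *\<^sub>R f) < 1 / real (Suc n)"
      using f by (simp add: gain_scaleR field_simps)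
    then show ?thesis by blast
  qed
  then obtain F where F: "\<And>n. norm (F n) = 1" "\<And>n. gain x 0 (F n) < 1 / real (Suc n)" by metis
  have "norm (F n) \<le> 1" for n using F(1) by simp
  from bounded_dual_weakstar_subsequence[OF sep, of F, OF this] obtain k f where k: "strict_mono (k :: nat \<Rightarrow> nat)"
    and lim: "\<And>z. (\<lambda>n. blinfun_apply (F (k n)) z) \<longlonglongrightarrow> blinfun_apply f z" by blast
  have lim0: "(\<lambda>n. 1 / real (Suc (k n))) \<longlonglongrightarrow> 0"
    using LIMSEQ_subseq_LIMSEQ[OF LIMSEQ_inverse_real_of_nat k] by (simp add: o_def inverse_eq_divide)
  have "gain x 0 f \<le> 0"
    by (rule gain_weakstar_lsc[OF lim less_imp_le[OF F(2)] lim0])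
  then have "gain x 0 f = 0" using gain_nonneg[of x 0 f] by simp
  then have "f = 0" using strict[of f] by (auto simp: gain_zero_iff)
  have "d \<le> 1 / real (Suc (k n)) + \<bar>blinfun_apply (F (k n)) (x - y)\<bar>" for n
  proof -
    have "d * norm (F (k n)) \<le> gain y 0 (F (k n))" using y by (simp add: coercive_at_def)
    then show ?thesis
      using F(1)[of "k n"] F(2)[of "k n"] gain_change_point[of y 0 "F (k n)" x] by simp
  qed
  moreover have "(\<lambda>n. 1 / real (Suc (k n)) + \<bar>blinfun_apply (F (k n)) (x - y)\<bar>) \<longlonglongrightarrow> 0 + \<bar>blinfun_apply f (x - y)\<bar>"
    by (intro tendsto_intros lim lim0)
  ultimately have "d \<le> 0 + \<bar>blinfun_apply f (x - y)\<bar>"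
    by (intro LIMSEQ_le_const) auto
  then show False using y \<open>f = 0\<close> by (simp add: coercive_at_def)
qed

lemma supp_hull_AE:
  assumes "z \<in> supp_hull \<mu>" and "AE \<omega> in P. a \<le> X f \<omega>"
  shows "a \<le> blinfun_apply f z"
proof -
  have "\<mu> {x. a \<le> blinfun_apply f x} = 1"
    using assms(2) by (simp add: halfspace_measure prob_eq_1)
  then show ?thesis using assms(1) by (auto simp: supp_hull_def halfspaces_def)
qed

text \<open>If \<open>a \<le> X f\<close> almost surely, then \<open>gain x 0 (- f)\<close> is at
  most the positive part of \<open>f x - a\<close>. Coercivity thus gives \<open>f x - a\<close> the
  margin \<open>c * norm f\<close>, and within distance \<open>c\<close> of \<open>x\<close> the
  functional cannot use it up.\<close>

lemma coercive_at_interior: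
  assumes "coercive_at x c"
  shows "x \<in> interior (supp_hull \<mu>)"
proof -
  have c: "c > 0" "\<And>f. c * norm f \<le> gain x 0 f" using assms by (auto simp: coercive_at_def)
  have "ball x c \<subseteq> supp_hull \<mu>"
    unfolding supp_hull_def
  proof clarify
    fix z H assume z: "z \<in> ball x c" and "H \<in> halfspaces" and 1: "\<mu> H = 1"
    then obtain f :: "'a dual" and a where H: "H = {x. a \<le> blinfun_apply f x}" by (auto simp: halfspaces_def)
    have ae: "AE \<omega> in P. a \<le> X f \<omega>" using 1 by (simp add: H halfspace_measure prob_eq_1)
    have "a \<le> blinfun_apply f z"
    proof (cases "f = 0")
      \<comment> \<open>The half-space is now empty or everything; its measure being 1 excludes the
        empty one.\<close>
      case True
      have "AE \<omega> in P. a \<le> 0" using ae X_zero unfolding True by eventually_elim simp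
      then show ?thesis using True by simp
    next
      case False
      have "gain x 0 (- f) \<le> expectation (\<lambda>_. max 0 (blinfun_apply f x - a))"
        unfolding gain_def
      proof (rule integral_mono_AE)
        show "AE \<omega> in P. max 0 (0 + X (- f) \<omega> - blinfun_apply (- f) x) \<le> max 0 (blinfun_apply f x - a)"
          using ae X_uminus[of f] by eventually_elim (auto simp: blinfun.minus_left)
      qed auto
      then have "c * norm f \<le> max 0 (blinfun_apply f x - a)"
        using c(2)[of "- f"] by (simp add: prob_space)
      moreover have "c * norm f > 0" using c False by simp
      ultimately have "c * norm f \<le> blinfun_apply f x - a" by (simp add: max_def split: if_splits)
      moreover have "\<bar>blinfun_apply f (x - z)\<bar> \<le> norm f * norm (x - z)"
        using norm_blinfun[of f "x - z"] by simp
      moreover have "norm f * norm (x - z) \<le> norm f * c"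
        using z by (intro mult_left_mono) (auto simp: dist_norm)
      ultimately show ?thesis by (simp add: blinfun.diff_right mult.commute)
    qed
    then show "z \<in> H" by (simp add: H)
  qed
  then show ?thesis using c(1) by (meson centre_in_ball interiorI open_ball)
qed

end

section \<open>Consequences of null hyperplanes\<close>

locale nonatomic_cylinder_law = cylinder_law \<mu> P X
  for \<mu> :: "'a::banach set \<Rightarrow> real" and P :: "'w measure" and X :: "'a dual \<Rightarrow> 'w \<Rightarrow> real" +
  assumes nonatomic: "(f :: 'a dual) \<noteq> 0 \<Longrightarrow> \<mu> {x. blinfun_apply f x = a} = 0"
begin

lemma X_neq:
  assumes "f \<noteq> 0" shows "AE \<omega> in P. X f \<omega> \<noteq> a"
  using nonatomic[OF assms, of a] marginal_measure[of "{a}" f] by (simp add: prob_eq_0)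

text \<open>Otherwise the half-space of points with \<open>f\<close>-value at most
  \<open>f x\<close> would contain the support hull, yet a small move from \<open>x\<close> in a
  direction \<open>v\<close> with \<open>f v > 0\<close> leaves the half-space and stays in the
  hull.\<close>

lemma interior_supp_hull_strict:
  assumes x: "x \<in> interior (supp_hull \<mu>)" and f: "f \<noteq> 0"
  shows "\<not> (AE \<omega> in P. X f \<omega> \<le> blinfun_apply f x)"
proof
  assume "AE \<omega> in P. X f \<omega> \<le> blinfun_apply f x"
  then have ae: "AE \<omega> in P. - blinfun_apply f x \<le> X (- f) \<omega>"
    using X_uminus[of f] by eventually_elim simp
  obtain r where r: "r > 0" "ball x r \<subseteq> supp_hull \<mu>" using x by (auto simp: mem_interior)
  obtain v where v: "blinfun_apply f v > 0"
    using f by (metis blinfun.minus_right blinfun_eqI linorder_neqE_linordered_idom neg_0_less_iff_less zero_blinfun.rep_eq)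
  then have v0: "v \<noteq> 0" by auto
  define s where "s = r / 2 / norm v"
  have "x + s *\<^sub>R v \<in> ball x r" using r v0 by (simp add: s_def dist_norm)
  then have "x + s *\<^sub>R v \<in> supp_hull \<mu>" using r by blast
  from supp_hull_AE[OF this ae] have "s * blinfun_apply f v \<le> 0"
    by (simp add: blinfun.minus_left blinfun.add_right blinfun.scaleR_right)
  moreover have "s > 0" using r v0 by (simp add: s_def)
  ultimately show False using v by (simp add: mult_le_0_iff)
qed

text \<open>The value of \<open>f\<close> at the barycenter is the mean \<open>t\<close> of
  \<open>X f\<close> over \<open>E\<close>. A variable bounded by its own mean is constant, so
  \<open>X f = t\<close> almost surely on \<open>E\<close>, which null hyperplanes and
  \<open>prob E > 0\<close> forbid.\<close>

lemma barycenter_strict: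
  assumes A: "A \<in> cylinder_sets" "\<mu> A > 0" and f: "f \<noteq> 0"
  shows "\<not> (AE \<omega> in P. X f \<omega> \<le> blinfun_apply f (barycenter \<mu> A))"
proof
  obtain E where E [measurable]: "E \<in> events" and \<mu>A: "\<mu> A = prob E"
    and b: "\<And>f. blinfun_apply f (barycenter \<mu> A) = (1 / prob E) * expectation (\<lambda>\<omega>. indicator E \<omega> * X f \<omega>)"
    using barycenter_event[OF A(1)] by metis
  define t where "t = blinfun_apply f (barycenter \<mu> A)"
  assume "AE \<omega> in P. X f \<omega> \<le> blinfun_apply f (barycenter \<mu> A)"
  then have le: "AE \<omega> in P. 0 \<le> indicator E \<omega> * (t - X f \<omega>)"
    by eventually_elim (simp add: t_def)
  have int: "integrable P (\<lambda>\<omega>. indicator E \<omega> * X f \<omega>)" "integrable P (\<lambda>\<omega>. t * indicator E \<omega>)"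
    "integrable P (\<lambda>\<omega>. indicator E \<omega> * (t - X f \<omega>))"
    by (simp_all add: integrable_weighted emeasure_eq_measure)
  have "expectation (\<lambda>\<omega>. t * indicator E \<omega> - indicator E \<omega> * X f \<omega>) = 0"
    using int(1,2) b[of f] A(2) \<mu>A by (subst Bochner_Integration.integral_diff) (simp_all add: t_def field_simps emeasure_eq_measure)
  then have "expectation (\<lambda>\<omega>. indicator E \<omega> * (t - X f \<omega>)) = 0" by (simp add: algebra_simps)
  then have "AE \<omega> in P. indicator E \<omega> * (t - X f \<omega>) = 0"
    using integral_nonneg_eq_0_iff_AE[OF int(3) le] by simp
  then have "AE \<omega> in P. \<omega> \<notin> E"
    using X_neq[OF f, of t] by eventually_elim (auto simp: indicator_def split: if_splits)
  then have "prob E = 0" using E by (simp add: prob_eq_0)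
  then show False using A(2) \<mu>A by simp
qed

text \<open>The direct method: coercivity bounds a minimising sequence, and weak* compactness with
  lower semicontinuity yields a minimiser.\<close>

lemma coercive_at_minimizer:
  assumes sep: "separable_space (euclidean :: 'a topology)" and x: "coercive_at x c"
  shows "\<exists>f. \<forall>g. gain x 1 f \<le> gain x 1 g"
proof -
  have c: "c > 0" "\<And>f. c * norm f \<le> gain x 0 f" using x by (auto simp: coercive_at_def)
  define m where "m = (INF f. gain x 1 f)"
  have bdd: "bdd_below (range (gain x 1))" by (rule bdd_belowI2[of _ 0]) (rule gain_nonneg)
  have "\<exists>f. gain x 1 f < m + 1 / real (Suc n)" for n
    using cINF_less_iff[OF _ bdd, of "m + 1 / real (Suc n)"] by (auto simp: m_def)
  then obtain F where F: "\<And>n. gain x 1 (F n) < m + 1 / real (Suc n)" by metis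
  have "norm (F n) \<le> (m + 1) / c" for n
  proof -
    have "c * norm (F n) \<le> gain x 1 (F n)" using c(2)[of "F n"] gain_mono[of 0 1 x "F n"] by simp
    moreover have "1 / real (Suc n) \<le> 1" by simp
    ultimately have "c * norm (F n) \<le> m + 1" using F[of n] by linarith
    then show ?thesis using c(1) by (simp add: field_simps)
  qed
  from bounded_dual_weakstar_subsequence[OF sep, of F, OF this] obtain k f where k: "strict_mono (k :: nat \<Rightarrow> nat)"
    and lim: "\<And>z. (\<lambda>n. blinfun_apply (F (k n)) z) \<longlonglongrightarrow> blinfun_apply f z" by blast
  have "(\<lambda>n. 1 / real (Suc (k n))) \<longlonglongrightarrow> 0"
    using LIMSEQ_subseq_LIMSEQ[OF LIMSEQ_inverse_real_of_nat k] by (simp add: o_def inverse_eq_divide)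
  then have "(\<lambda>n. m + 1 / real (Suc (k n))) \<longlonglongrightarrow> m + 0" by (intro tendsto_intros)
  then have "gain x 1 f \<le> m + 0"
    by (rule gain_weakstar_lsc[OF lim less_imp_le[OF F]])
  moreover have "m \<le> gain x 1 g" for g
    unfolding m_def by (rule cINF_lower[OF bdd]) simp
  ultimately show ?thesis by (metis add.right_neutral order_trans)
qed

text \<open>The difference quotients of \<open>gain x 1\<close> at \<open>f\<close> in direction
  \<open>g\<close> are nonnegative and lie below the expectations of \<open>W n\<close>. These
  converge by domination to the claimed expectation, since the kink \<open>Y = 0\<close> of the
  positive part is null.\<close>

lemma minimizer_first_order:
  assumes min: "\<And>g. gain x 1 f \<le> gain x 1 g"
  defines "E \<equiv> {\<omega> \<in> space P. blinfun_apply f x - 1 \<le> X f \<omega>}"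
  shows "0 \<le> expectation (\<lambda>\<omega>. indicator E \<omega> * (X g \<omega> - blinfun_apply g x))"
proof -
  define Y where "Y \<omega> = 1 + X f \<omega> - blinfun_apply f x" for \<omega>
  define Z where "Z \<omega> = X g \<omega> - blinfun_apply g x" for \<omega>
  have [measurable]: "Y \<in> borel_measurable P" "Z \<in> borel_measurable P"
    unfolding Y_def Z_def by measurable
  have E [measurable]: "E \<in> sets P" unfolding E_def by measurable
  have int: "integrable P Y" "integrable P Z" by (simp_all add: Y_def[abs_def] Z_def[abs_def])
  \<comment> \<open>\<open>W n\<close> uses the subgradient of the positive part at the perturbed
    point; convexity then bounds the increment from above. The subgradient at \<open>Y\<close> would
    bound it from below.\<close>
  define W where "W n \<omega> = of_bool (0 < Y \<omega> + Z \<omega> / real (Suc n)) * Z \<omega>" for n \<omega>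
  have intW: "integrable P (W n)" for n
    unfolding W_def[abs_def] by (rule integrable_weighted) (use int in auto)
  have Y_neq: "AE \<omega> in P. Y \<omega> \<noteq> 0"
  proof (cases "f = 0")
    \<comment> \<open>Here \<open>Y\<close> equals 1 almost surely, although the zero functional has
      no null hyperplane property.\<close>
    case True
    then show ?thesis using X_zero by (auto simp: Y_def)
  next
    case False
    then show ?thesis using X_neq[OF False, of "blinfun_apply f x - 1"] by (auto simp: Y_def)
  qed
  have W_nonneg: "0 \<le> expectation (W n)" for n
  proof -
    define t where "t = 1 / real (Suc n)"
    have t: "t > 0" by (simp add: t_def)
    have "gain x 1 (f + t *\<^sub>R g) = expectation (\<lambda>\<omega>. max 0 (Y \<omega> + t * Z \<omega>))"
      unfolding gain_def
    proof (rule integral_cong_AE)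
      show "AE \<omega> in P. max 0 (1 + X (f + t *\<^sub>R g) \<omega> - blinfun_apply (f + t *\<^sub>R g) x) = max 0 (Y \<omega> + t * Z \<omega>)"
        using X_add[of f "t *\<^sub>R g"] X_scaleR[of t g]
        by eventually_elim (simp add: Y_def Z_def blinfun.add_left blinfun.scaleR_left algebra_simps)
    qed measurable
    moreover have "gain x 1 f = expectation (\<lambda>\<omega>. max 0 (Y \<omega>))"
      by (simp add: gain_def Y_def)
    ultimately have "0 \<le> expectation (\<lambda>\<omega>. max 0 (Y \<omega> + t * Z \<omega>)) - expectation (\<lambda>\<omega>. max 0 (Y \<omega>))"
      using min[of "f + t *\<^sub>R g"] by simp
    also have "\<dots> = expectation (\<lambda>\<omega>. max 0 (Y \<omega> + t * Z \<omega>) - max 0 (Y \<omega>))"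
      using int by (simp add: Bochner_Integration.integral_diff)
    also have "\<dots> \<le> expectation (\<lambda>\<omega>. t * W n \<omega>)"
    proof (rule integral_mono)
      show "max 0 (Y \<omega> + t * Z \<omega>) - max 0 (Y \<omega>) \<le> t * W n \<omega>" for \<omega>
        by (auto simp: W_def t_def)
    qed (use int intW in auto)
    finally show ?thesis using t by (simp add: zero_le_mult_iff)
  qed
  have "(\<lambda>n. expectation (W n)) \<longlonglongrightarrow> expectation (\<lambda>\<omega>. indicator E \<omega> * Z \<omega>)"
  proof (rule integral_dominated_convergence)
    show "integrable P (\<lambda>\<omega>. \<bar>Z \<omega>\<bar>)" using int by simp
    show "W n \<in> borel_measurable P" for n using intW by simp
    show "AE \<omega> in P. norm (W n \<omega>) \<le> \<bar>Z \<omega>\<bar>" for n by (rule AE_I2) (simp add: W_def)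
    show "AE \<omega> in P. (\<lambda>n. W n \<omega>) \<longlonglongrightarrow> indicator E \<omega> * Z \<omega>"
      using Y_neq AE_space
    proof eventually_elim
      case (elim \<omega>)
      have "(\<lambda>n. Y \<omega> + Z \<omega> * inverse (real (Suc n))) \<longlonglongrightarrow> Y \<omega> + Z \<omega> * 0"
        by (intro tendsto_intros LIMSEQ_inverse_real_of_nat)
      then have lim: "(\<lambda>n. Y \<omega> + Z \<omega> / real (Suc n)) \<longlonglongrightarrow> Y \<omega>"
        by (simp add: divide_inverse)
      have "\<forall>\<^sub>F n in sequentially. W n \<omega> = indicator E \<omega> * Z \<omega>"
      proof (cases "Y \<omega> > 0")
        case True
        then have "\<omega> \<in> E" using elim by (simp add: E_def Y_def)
        then show ?thesis
          by (intro eventually_mono[OF order_tendstoD(1)[OF lim True]]) (simp add: W_def)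
      next
        case False
        then have "Y \<omega> < 0" using elim by simp
        then have "\<omega> \<notin> E" by (simp add: E_def Y_def)
        then show ?thesis
          by (intro eventually_mono[OF order_tendstoD(2)[OF lim \<open>Y \<omega> < 0\<close>]]) (simp add: W_def)
      qed
      then show ?case by (rule tendsto_eventually)
    qed
  qed measurable
  then have "0 \<le> expectation (\<lambda>\<omega>. indicator E \<omega> * Z \<omega>)"
    by (rule LIMSEQ_le_const) (use W_nonneg in auto)
  then show ?thesis by (simp add: Z_def)
qed

text \<open>The first-order condition for both \<open>g\<close> and \<open>- g\<close> becomes an
  equality, which says that the mean of \<open>X g\<close> over \<open>E\<close> is
  \<open>g x\<close>.\<close>

lemma coercive_at_halfspace_barycenter:
  assumes sep: "separable_space (euclidean :: 'a topology)" and x: "coercive_at x c"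
  shows "\<exists>H\<in>halfspaces. \<mu> H > 0 \<and> x = barycenter \<mu> H"
proof -
  obtain f where min: "\<And>g. gain x 1 f \<le> gain x 1 g"
    using coercive_at_minimizer[OF assms] by blast
  define a where "a = blinfun_apply f x - 1"
  define E where "E = {\<omega> \<in> space P. a \<le> X f \<omega>}"
  have E [measurable]: "E \<in> sets P" unfolding E_def by measurable
  have intE: "integrable P (\<lambda>\<omega>. indicator E \<omega> * Z \<omega>)" if "integrable P Z" for Z :: "'w \<Rightarrow> real"
    by (rule integrable_weighted) (use that in \<open>auto simp: indicator_def\<close>)
  have ge: "0 \<le> expectation (\<lambda>\<omega>. indicator E \<omega> * (X g \<omega> - blinfun_apply g x))" for g
    using minimizer_first_order[OF min, of g] by (simp add: E_def a_def)
  have le: "expectation (\<lambda>\<omega>. indicator E \<omega> * (X g \<omega> - blinfun_apply g x)) \<le> 0" for g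
  proof -
    have "expectation (\<lambda>\<omega>. indicator E \<omega> * (X (- g) \<omega> - blinfun_apply (- g) x)) =
        expectation (\<lambda>\<omega>. - (indicator E \<omega> * (X g \<omega> - blinfun_apply g x)))"
    proof (rule integral_cong_AE)
      show "AE \<omega> in P. indicator E \<omega> * (X (- g) \<omega> - blinfun_apply (- g) x) =
          - (indicator E \<omega> * (X g \<omega> - blinfun_apply g x))"
        using X_uminus[of g] by eventually_elim (simp add: blinfun.minus_left algebra_simps)
    qed measurable
    then show ?thesis using ge[of "- g"] by simp
  qed
  have mean: "expectation (\<lambda>\<omega>. indicator E \<omega> * X g \<omega>) = blinfun_apply g x * prob E" for g
  proof -
    have "integrable P (\<lambda>\<omega>. blinfun_apply g x * indicator E \<omega>)"
      by (simp add: emeasure_eq_measure)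
    then have "expectation (\<lambda>\<omega>. indicator E \<omega> * X g \<omega> - blinfun_apply g x * indicator E \<omega>) =
        expectation (\<lambda>\<omega>. indicator E \<omega> * X g \<omega>) - blinfun_apply g x * prob E"
      using intE[OF integrable_X[of g]] by (subst Bochner_Integration.integral_diff) simp_all
    moreover have "expectation (\<lambda>\<omega>. indicator E \<omega> * X g \<omega> - blinfun_apply g x * indicator E \<omega>) = 0"
      using ge[of g] le[of g] by (simp add: algebra_simps)
    ultimately show ?thesis by simp
  qed
  \<comment> \<open>If \<open>E\<close> were null, \<open>X f\<close> would stay below
    \<open>f x - 1\<close>, so \<open>gain x 0 f = 0\<close> and coercivity forces
    \<open>f = 0\<close>. But then \<open>a = -1\<close>, and \<open>X 0 = 0\<close> lies above it
    almost surely.\<close>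
  have pos: "prob E > 0"
  proof (rule ccontr)
    assume "\<not> ?thesis"
    then have "prob E = 0" by (simp add: not_less measure_le_0_iff)
    then have lt: "AE \<omega> in P. X f \<omega> < a" using AE_space by (simp add: prob_eq_0) (auto simp: E_def)
    then have "gain x 0 f = 0" by (auto simp: gain_zero_iff a_def)
    then have "f = 0" using x by (auto simp: coercive_at_def dest!: spec[of _ f] simp: mult_le_0_iff)
    have "AE \<omega> in P. 0 < a" using lt X_zero unfolding \<open>f = 0\<close> by eventually_elim simp
    then show False using \<open>f = 0\<close> by (simp add: a_def)
  qed
  define H where "H = {y. blinfun_apply f y \<ge> a}"
  have "\<mu> H > 0" using pos by (simp add: H_def E_def halfspace_measure)
  moreover have "barycenter \<mu> H = x"
  proof (rule dual_ext)
    fix g :: "'a dual"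
    show "blinfun_apply g (barycenter \<mu> H) = blinfun_apply g x"
      using mean[of g] pos unfolding H_def barycenter_halfspace_apply E_def[symmetric] by simp
  qed
  moreover have "H \<in> halfspaces" by (auto simp: H_def halfspaces_def)
  ultimately show ?thesis by blast
qed

text \<open>With \<open>\<eta> = 1\<^sub>E / P E - 1\<^sub>F / P F\<close>, equality of the barycenters gives \<open>E (\<eta> (X f - a)) = 0\<close>, while
  \<open>P E \<le> P F\<close> makes \<open>\<eta>\<close> and \<open>X f - a\<close> have the same sign everywhere.\<close>

lemma halfspace_events_AE_eq:
  fixes f g :: "'a dual" and a b :: real
  defines "E \<equiv> {\<omega> \<in> space P. X f \<omega> \<ge> a}" and "F \<equiv> {\<omega> \<in> space P. X g \<omega> \<ge> b}"
  assumes pos: "0 < prob E" and le: "prob E \<le> prob F"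
    and eq: "barycenter \<mu> {x. blinfun_apply f x \<ge> a} = barycenter \<mu> {x. blinfun_apply g x \<ge> b}"
  shows "AE \<omega> in P. \<omega> \<in> E \<longleftrightarrow> \<omega> \<in> F"
proof (cases "f = 0")
  \<comment> \<open>\<open>X_neq\<close> does not cover \<open>f = 0\<close>. Here \<open>E\<close>
    is null or almost sure; positivity leaves the second case, and \<open>F\<close> has at least the
    same probability.\<close>
  case True
  have E [measurable]: "E \<in> sets P" and F [measurable]: "F \<in> sets P"
    unfolding E_def F_def by measurable
  have "\<not> (AE \<omega> in P. \<omega> \<notin> E)" using pos by (simp flip: prob_eq_0)
  moreover have "AE \<omega> in P. \<omega> \<in> E \<longleftrightarrow> a \<le> 0"
    using X_zero AE_space by eventually_elim (simp add: E_def True)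
  ultimately have "a \<le> 0" by (smt (verit) eventually_mono)
  then have AE_E: "AE \<omega> in P. \<omega> \<in> E" using \<open>AE \<omega> in P. \<omega> \<in> E \<longleftrightarrow> a \<le> 0\<close> by simp
  then have "prob E = 1" by (simp add: prob_eq_1)
  then have "prob F = 1" using le prob_le_1[of F] by simp
  then have "AE \<omega> in P. \<omega> \<in> F" by (simp add: prob_eq_1)
  then show ?thesis using AE_E by eventually_elim simp
next
  case False
  have E [measurable]: "E \<in> sets P" and F [measurable]: "F \<in> sets P"
    unfolding E_def F_def by measurable
  have posF: "prob F > 0" using pos le by simp
  define h where "h D \<omega> = (1 / prob D) * (indicator D \<omega> * (X f \<omega> - a))" for D \<omega>
  have h: "integrable P (h D)" "expectation (h D) = (1 / prob D) * expectation (\<lambda>\<omega>. indicator D \<omega> * X f \<omega>) - a"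
    if D: "D \<in> sets P" "prob D > 0" for D
  proof -
    have i: "integrable P (\<lambda>\<omega>. indicator D \<omega> * X f \<omega>)" "integrable P (\<lambda>\<omega>. a * indicator D \<omega>)"
      using D by (auto intro!: integrable_weighted simp: emeasure_eq_measure)
    have h': "h D = (\<lambda>\<omega>. (1 / prob D) * (indicator D \<omega> * X f \<omega> - a * indicator D \<omega>))"
      by (simp add: h_def fun_eq_iff algebra_simps)
    show "integrable P (h D)" unfolding h'
      by (intro integrable_mult_right Bochner_Integration.integrable_diff i)
    have "expectation (h D) = (1 / prob D) * (expectation (\<lambda>\<omega>. indicator D \<omega> * X f \<omega>) - a * prob D)"
      unfolding h' using i D by (simp add: Bochner_Integration.integral_diff del: integrable_mult_right_iff)
    then show "expectation (h D) = (1 / prob D) * expectation (\<lambda>\<omega>. indicator D \<omega> * X f \<omega>) - a"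
      using D by (simp add: field_simps)
  qed
  have nonneg: "AE \<omega> in P. 0 \<le> h E \<omega> - h F \<omega>"
  proof (rule AE_I2)
    fix \<omega> assume \<omega>: "\<omega> \<in> space P"
    have inv: "1 / prob F \<le> 1 / prob E" using pos le by (simp add: frac_le)
    show "0 \<le> h E \<omega> - h F \<omega>"
    proof (cases "\<omega> \<in> E")
      case True
      then have "X f \<omega> - a \<ge> 0" by (simp add: E_def)
      then show ?thesis using True mult_right_mono[OF inv, of "X f \<omega> - a"] pos
        by (auto simp: h_def indicator_def)
    next
      case False
      then have "X f \<omega> - a \<le> 0" using \<omega> by (simp add: E_def)
      then show ?thesis using False posF
        by (auto simp: h_def indicator_def divide_nonpos_pos)
    qed
  qed
  \<comment> \<open>Evaluating both barycenters at the single functional \<open>f\<close>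
    suffices.\<close>
  have "expectation (h E) = expectation (h F)"
    using barycenter_halfspace_apply[of f a f] barycenter_halfspace_apply[of f b g] eq
    by (simp add: h pos posF flip: E_def F_def)
  then have "expectation (\<lambda>\<omega>. h E \<omega> - h F \<omega>) = 0"
    by (simp add: Bochner_Integration.integral_diff h pos posF)
  then have "AE \<omega> in P. h E \<omega> - h F \<omega> = 0"
    using integral_nonneg_eq_0_iff_AE[OF _ nonneg] h(1) pos posF by simp
  \<comment> \<open>Where exactly one of the two events occurs, the difference is a nonzero multiple
    of \<open>X f - a\<close>, which vanishes only on a null set.\<close>
  then show ?thesis
    using X_neq[OF False, of a]
  proof eventually_elim
    case (elim \<omega>)
    then show ?case using pos posF
      by (cases "\<omega> \<in> E"; cases "\<omega> \<in> F") (auto simp: h_def)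
  qed
qed

lemma halfspace_barycenter_unique:
  assumes "H \<in> halfspaces" "G \<in> halfspaces" "\<mu> H > 0" "\<mu> G > 0" "barycenter \<mu> H = barycenter \<mu> G"
  shows "\<mu> (sym_diff H G) = 0"
proof -
  obtain f g :: "'a dual" and a b
    where H: "H = {x. blinfun_apply f x \<ge> a}" and G: "G = {x. blinfun_apply g x \<ge> b}"
    using assms by (auto simp: halfspaces_def)
  let ?E = "{\<omega> \<in> space P. X f \<omega> \<ge> a}" and ?F = "{\<omega> \<in> space P. X g \<omega> \<ge> b}"
  have pos: "prob ?E > 0" "prob ?F > 0" using assms by (simp_all add: H G halfspace_measure)
  have "AE \<omega> in P. \<omega> \<in> ?E \<longleftrightarrow> \<omega> \<in> ?F"
  proof (cases "prob ?E \<le> prob ?F")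
    case True
    show ?thesis
      by (rule halfspace_events_AE_eq[OF pos(1) True assms(5)[unfolded H G]])
  next
    case False
    then have "prob ?F \<le> prob ?E" by simp
    from halfspace_events_AE_eq[OF pos(2) this assms(5)[unfolded H G, symmetric]]
    show ?thesis by eventually_elim blast
  qed
  then have "AE \<omega> in P. \<omega> \<notin> sym_diff ?E ?F" by eventually_elim blast
  then show ?thesis
    unfolding H G sym_diff_halfspaces_measure by (subst prob_eq_0) auto
qed

end

theorem theorem2:
  fixes \<mu> :: "'a::banach set \<Rightarrow> real"
    and P :: "'w measure"
    and X :: "'a dual \<Rightarrow> 'w \<Rightarrow> real"
  assumes "reflexive_space TYPE('a)"
    and "separable_space (euclidean :: 'a topology)"
    and "cylinder_prob_measure1 \<mu>"
    and "generalized_random_element P X"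
    and "has_cylinder_law P X \<mu>"
    and "\<forall>(f :: 'a dual) (a :: real). f \<noteq> 0 \<longrightarrow> \<mu> {x. blinfun_apply f x = a} = 0"
    and "interior (trimmed_region0 P X) \<noteq> {}"
  shows "barycenters \<mu> = interior (supp_hull \<mu>)
    \<and> (\<forall>x\<in>barycenters \<mu>. \<exists>H\<in>halfspaces. \<mu> H > 0 \<and> x = barycenter \<mu> H)
    \<and> (\<forall>H\<in>halfspaces. \<forall>G\<in>halfspaces.
          \<mu> H > 0 \<and> \<mu> G > 0 \<and> barycenter \<mu> H = barycenter \<mu> G \<longrightarrow> \<mu> (sym_diff H G) = 0)"
proof -
  interpret nonatomic_cylinder_law \<mu> P X
    by unfold_locales (use assms in auto)
  obtain y d where y: "coercive_at y d" using ex_coercive assms(7) by blast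
  have coercive: "\<exists>c. coercive_at x c"
    if "\<And>f. f \<noteq> 0 \<Longrightarrow> \<not> (AE \<omega> in P. X f \<omega> \<le> blinfun_apply f x)" for x
    by (rule coercive_at_change_point[OF assms(2) y that])
  have bary: "\<exists>c. coercive_at x c" if "x \<in> barycenters \<mu>" for x
    using that coercive barycenter_strict unfolding barycenters_def by blast
  have half: "\<exists>H\<in>halfspaces. \<mu> H > 0 \<and> x = barycenter \<mu> H" if "\<exists>c. coercive_at x c" for x
    using that coercive_at_halfspace_barycenter[OF assms(2)] by blast
  \<comment> \<open>Coercivity links the two sets: an interior point is coercive, hence the
    barycenter of a half-space, and half-spaces are cylinders.\<close>
  have "x \<in> barycenters \<mu>" if "x \<in> interior (supp_hull \<mu>)" for x
    using half[OF coercive[OF interior_supp_hull_strict[OF that]]] halfspace_cylinder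
    unfolding barycenters_def by blast
  then have "barycenters \<mu> = interior (supp_hull \<mu>)"
    using bary coercive_at_interior by blast
  moreover have "\<forall>x\<in>barycenters \<mu>. \<exists>H\<in>halfspaces. \<mu> H > 0 \<and> x = barycenter \<mu> H"
    using bary half by blast
  ultimately show ?thesis using halfspace_barycenter_unique by blast
qed

end
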